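(* Let complex coefficients $\beta^m_{j,k}(x_0)$ ($(j,x_0)\in\mathcal{J}$, $m\in\mathbb{Z}$) and $h^m_{1,1,k},h^m_{2,1,k},h^m_{2,2,k}$ ($m\in\mathbb{Z}$) be given such that the operators $\mathfrak{R}_{j,k}(x_0):H^{1/2}(\gamma_{x_0})\to H^{-1/2}(\gamma_{x_0})$ are bounded and linear for all $(j,x_0)\in\mathcal{J}$, and the anti-linear forms $\mathfrak{F}_{1,1,k}$ on $H^{1/2}(\gamma_\xi)$, $\mathfrak{F}_{2,1,k}$ on $H^{1/2}(\gamma_1)$ and $\mathfrak{F}_{2,2,k}$ on $H^{1/2}(\gamma_\xi)$ are bounded. 1. Assume there is a function $\mu_{\mathrm R}:\{k\in\mathbb{C}\setminus\{0\}:\operatorname{Im}k\ge0\}\to\mathbb{R}_{\ge0}$, with $\mu_{\mathrm R}(k)>0$ whenever $\operatorname{Im}k>0$, such that for all $(j,x)\in\mathcal{J}$, all $k\in\mathbb{C}\setminus\{0\}$ with $\operatorname{Im}k\ge0$, and all $u\in H^{1/2}(\gamma_x)\setminus\{0\}$: $$-\operatorname{Re}(\mathfrak{R}_{j,k}(x)u,u)_{\gamma_x}\ge\mu_{\mathrm R}(k)\|u\|_{\gamma_x}^2\quad\text{if }\operatorname{Im}k>0,$$ $$(\operatorname{sign}\operatorname{Re}k)\operatorname{Im}(\mathfrak{R}_{j,k}(x)u,u)_{\gamma_x}>0\quad\text{if }\operatorname{Re}k\neq0.$$ Then problems (P11), (P21), (P22) are well-posed for every $k\in\mathbb{C}\setminus\{0\}$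 with $\operatorname{Im}k\ge0$. 2. Assume there is a function $\mu_{\mathrm R}:\{k\in\mathbb{C}\setminus\{0\}:\operatorname{Im}k\le0\}\to\mathbb{R}_{\ge0}$, with $\mu_{\mathrm R}(k)>0$ whenever $\operatorname{Im}k<0$, such that for all $(j,x)\in\mathcal{J}$, all $k\in\mathbb{C}$ with $\operatorname{Im}k<0$, and all $u\in H^{1/2}(\gamma_x)\setminus\{0\}$: $$-\operatorname{Re}(\mathfrak{R}_{j,k}(x)u,u)_{\gamma_x}\ge\mu_{\mathrm R}(k)\|u\|_{\gamma_x}^2,$$ $$-(\operatorname{sign}\operatorname{Re}k)\operatorname{Im}(\mathfrak{R}_{j,k}(x)u,u)_{\gamma_x}>0\quad\text{if }\operatorname{Re}k\neq0.$$ Then problems (P11), (P21), (P22) are well-posed for every $k\in\mathbb{C}$ with $\operatorname{Im}k<0$.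
   Context: Fix $\xi\in(0,1)$ and set $\tau_1=(0,\xi)$, $\tau_2=(\xi,1)$, $\Omega_j=\{x\in\mathbb{R}^2:|x|\in\tau_j\}$, $\gamma_x=\{y\in\mathbb{R}^2:|y|=x\}$ for $x\in\{\xi,1\}$, and $\mathcal{J}=\{(1,\xi),(2,\xi),(2,1)\}$. Let $\hat n:(0,1)\to\mathbb{R}$ satisfy $0<\inf\hat n\le\sup\hat n<\infty$, with $\hat n_j:=\hat n|_{\tau_j}\in C^\infty(\tau_j)$ and $\hat n_j$ Lipschitz continuous (piecewise Lipschitz continuous refractive index). For $m\in\mathbb{Z}$ and $k\in\mathbb{C}\setminus\{0\}$ let $$L^m_{j,k}v=-\frac1r(rv')'+\Bigl(\frac{m^2}{r^2}-(k\hat n_j)^2\Bigr)v\ \text{ in }\tau_j,\qquad B^m_{1,k}(0)v=\begin{cases}v(0)&m\text{ odd},\\ v'(0)&m\text{ even.}\end{cases}$$ The problems, for each $m\in\mathbb{Z}$ and with given nonzero data $h^m_{j,\ell,k}\in\mathbb{C}$, are: (P11) $L^m_{1,k}f=0$ in $\tau_1$, $\ B^m_{1,k}(0)f=0$, $\ f'(\xi)-\beta^m_{1,k}(\xi)f(\xi)=h^m_{1,1,k}$; (P21) $L^m_{2,k}f=0$ in $\tau_2$, $\ -f'(\xi)-\beta^m_{2,k}(\xi)f(\xi)=0$, $\ f'(1)-\beta^m_{2,k}(1)f(1)=h^m_{2,1,k}$; (P22) $L^m_{2,k}f=0$ in $\tau_2$, $\ -f'(\xi)-\beta^m_{2,k}(\xi)f(\xi)=h^m_{2,2,k}$,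 $\ f'(1)-\beta^m_{2,k}(1)f(1)=0$. A problem is well-posed if for every $m\in\mathbb{Z}$ it has exactly one solution $f$ with $f(r)e^{im\theta}\in H^1(\Omega_j)$ ($j=1$ for (P11), $j=2$ for (P21), (P22)), depending continuously on the data. For a function $u=\sum_{m\in\mathbb{Z}}u_me^{im\theta}$ on $\gamma_{x_0}$ and $(j,x_0)\in\mathcal{J}$, set $\mathfrak{R}_{j,k}(x_0)u=\sum_{m\in\mathbb{Z}}\beta^m_{j,k}(x_0)u_me^{im\theta}$. With $\mathfrak{h}_{j,\ell,k}=\sum_{m\in\mathbb{Z}}h^m_{j,\ell,k}e^{im\theta}$, set $\mathfrak{F}_{1,1,k}(v)=\int_{\gamma_\xi}\mathfrak{h}_{1,1,k}\overline v$, $\mathfrak{F}_{2,1,k}(v)=\int_{\gamma_1}\mathfrak{h}_{2,1,k}\overline v$, $\mathfrak{F}_{2,2,k}(v)=\int_{\gamma_\xi}\mathfrak{h}_{2,2,k}\overline v$. $(\cdot,\cdot)_{\gamma_x}$ is the $L^2(\gamma_x)$ scalar product (linear in the first argument), extended to the $H^{-1/2}\times H^{1/2}$ duality pairing, and $\|\cdot\|_{\gamma_x}$ is the $L^2(\gamma_x)$ norm. *)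

theory Defs
  imports "HOL-Analysis.Analysis"
begin

definition L2_on :: "'a::euclidean_space set \<Rightarrow> ('a \<Rightarrow> complex) \<Rightarrow> bool" where
  "L2_on A u \<longleftrightarrow> set_borel_measurable lebesgue A u \<and>
     set_integrable lebesgue A (\<lambda>x. (cmod (u x))\<^sup>2)"

primrec Ck :: "nat \<Rightarrow> ('a::euclidean_space \<Rightarrow> real) \<Rightarrow> bool" where
  "Ck 0 f \<longleftrightarrow> continuous_on UNIV f"
| "Ck (Suc n) f \<longleftrightarrow> (\<forall>x. f differentiable at x) \<and>
     (\<forall>b\<in>Basis. Ck n (\<lambda>x. frechet_derivative f (at x) b))"

definition test_function :: "'a::euclidean_space set \<Rightarrow> ('a \<Rightarrow> real) \<Rightarrow> bool" where
  "test_function A \<phi> \<longleftrightarrow> (\<forall>n. Ck n \<phi>) \<and>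
     compact (closure {x. \<phi> x \<noteq> 0}) \<and> closure {x. \<phi> x \<noteq> 0} \<subseteq> A"

text \<open>Real-valued test functions suffice, since the integrals below are linear in \<open>\<phi>\<close>.\<close>

definition weak_partial ::
    "'a::euclidean_space set \<Rightarrow> 'a \<Rightarrow> ('a \<Rightarrow> complex) \<Rightarrow> ('a \<Rightarrow> complex) \<Rightarrow> bool" where
  "weak_partial A b u g \<longleftrightarrow> (\<forall>\<phi>. test_function A \<phi> \<longrightarrow>
     (LINT x:A|lebesgue. frechet_derivative \<phi> (at x) b *\<^sub>R u x) =
     - (LINT x:A|lebesgue. \<phi> x *\<^sub>R g x))"

definition weak_gradient ::
    "'a::euclidean_space set \<Rightarrow> ('a \<Rightarrow> complex) \<Rightarrow> ('a \<Rightarrow> 'a \<Rightarrow> complex) \<Rightarrow> bool" where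
  "weak_gradient A u G \<longleftrightarrow> (\<forall>b\<in>Basis. L2_on A (G b) \<and> weak_partial A b u (G b))"

definition H1 :: "'a::euclidean_space set \<Rightarrow> ('a \<Rightarrow> complex) set" where
  "H1 A = {u. L2_on A u \<and> (\<exists>G. weak_gradient A u G)}"

text \<open>For \<open>u \<in> H1 A\<close> with \<open>A\<close> open, weak gradients are unique up to null sets, so the set
  below has exactly one element and the infimum just picks it.\<close>

definition H1_norm :: "'a::euclidean_space set \<Rightarrow> ('a \<Rightarrow> complex) \<Rightarrow> real" where
  "H1_norm A u = Inf {sqrt ((LINT x:A|lebesgue. (cmod (u x))\<^sup>2)
       + (\<Sum>b\<in>Basis. LINT x:A|lebesgue. (cmod (G b x))\<^sup>2)) | G. weak_gradient A u G}"

text \<open>The plane is identified with \<open>complex\<close>. A function on the circle of radius \<open>x\<close> is a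
  function on \<open>complex\<close> of which only the values at the points \<open>x * cis \<theta>\<close> matter. Elements of
  Sobolev spaces of negative order on the circle (formal series \<open>\<Sum>m. c m * cis (m * \<theta>)\<close>) are
  represented by their coefficient sequences \<open>c\<close>.\<close>

definition circle_coeff :: "real \<Rightarrow> (complex \<Rightarrow> complex) \<Rightarrow> int \<Rightarrow> complex" where
  "circle_coeff x u m =
     (LINT \<theta>:{0..2*pi}|lebesgue. u (of_real x * cis \<theta>) * cis (- (of_int m * \<theta>))) / of_real (2 * pi)"

definition circle_norm :: "real \<Rightarrow> (complex \<Rightarrow> complex) \<Rightarrow> real" where
  "circle_norm x u = sqrt (x * (LINT \<theta>:{0..2*pi}|lebesgue. (cmod (u (of_real x * cis \<theta>)))\<^sup>2))"

definition Hs_coeffs :: "real \<Rightarrow> (int \<Rightarrow> complex) set" where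
  "Hs_coeffs s = {c. (\<lambda>m. (1 + (of_int m)\<^sup>2) powr s * (cmod (c m))\<^sup>2) summable_on UNIV}"

definition Hs_norm :: "real \<Rightarrow> real \<Rightarrow> (int \<Rightarrow> complex) \<Rightarrow> real" where
  "Hs_norm s x c =
     sqrt (2 * pi * x * (\<Sum>\<^sub>\<infinity>m. (1 + (of_int m)\<^sup>2) powr s * (cmod (c m))\<^sup>2))"

definition H_half :: "real \<Rightarrow> (complex \<Rightarrow> complex) set" where
  "H_half x = {u. L2_on {0..2*pi} (\<lambda>\<theta>. u (of_real x * cis \<theta>)) \<and>
     circle_coeff x u \<in> Hs_coeffs (1/2)}"

definition circle_null :: "real \<Rightarrow> (complex \<Rightarrow> complex) \<Rightarrow> bool" where
  "circle_null x u \<longleftrightarrow> (AE \<theta> in lebesgue. \<theta> \<in> {0..2*pi} \<longrightarrow> u (of_real x * cis \<theta>) = 0)"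

text \<open>By Parseval's identity this extends the \<open>L\<^sup>2\<close> scalar product of the circle of radius \<open>x\<close>
  (arc length measure) to the duality pairing between orders \<open>-1/2\<close> and \<open>1/2\<close>.\<close>

definition circle_pairing :: "real \<Rightarrow> (int \<Rightarrow> complex) \<Rightarrow> (complex \<Rightarrow> complex) \<Rightarrow> complex" where
  "circle_pairing x c v = of_real (2 * pi * x) * (\<Sum>\<^sub>\<infinity>m. c m * cnj (circle_coeff x v m))"

definition mult_op :: "(int \<Rightarrow> complex) \<Rightarrow> real \<Rightarrow> (complex \<Rightarrow> complex) \<Rightarrow> int \<Rightarrow> complex" where
  "mult_op \<beta> x u = (\<lambda>m. \<beta> m * circle_coeff x u m)"

definition bounded_linear_half ::
    "real \<Rightarrow> ((complex \<Rightarrow> complex) \<Rightarrow> int \<Rightarrow> complex) \<Rightarrow> bool" where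
  "bounded_linear_half x T \<longleftrightarrow>
     (\<forall>u\<in>H_half x. \<forall>v\<in>H_half x. \<forall>a b.
        T (\<lambda>z. a * u z + b * v z) = (\<lambda>m. a * T u m + b * T v m)) \<and>
     (\<forall>u\<in>H_half x. T u \<in> Hs_coeffs (-1/2)) \<and>
     (\<exists>C. \<forall>u\<in>H_half x. Hs_norm (-1/2) x (T u) \<le> C * Hs_norm (1/2) x (circle_coeff x u))"

text \<open>The form \<open>v \<mapsto> \<integral> (\<Sum>m. c m * cis (m * \<theta>)) * cnj v\<close> on \<open>H_half x\<close> is well defined,
  anti-linear and bounded. Summability is explicit because \<open>infsum\<close> of a non-summable family
  is \<open>0\<close>.\<close>

definition bounded_antilinear_form :: "real \<Rightarrow> (int \<Rightarrow> complex) \<Rightarrow> bool" where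
  "bounded_antilinear_form x c \<longleftrightarrow>
     (\<forall>v\<in>H_half x. (\<lambda>m. c m * cnj (circle_coeff x v m)) summable_on UNIV) \<and>
     (\<forall>u\<in>H_half x. \<forall>v\<in>H_half x. \<forall>a b.
        circle_pairing x c (\<lambda>z. a * u z + b * v z) =
        cnj a * circle_pairing x c u + cnj b * circle_pairing x c v) \<and>
     (\<exists>C. \<forall>v\<in>H_half x. cmod (circle_pairing x c v) \<le> C * Hs_norm (1/2) x (circle_coeff x v))"

definition tau :: "real \<Rightarrow> nat \<Rightarrow> real set" where
  "tau \<xi> j = (if j = 1 then {0<..<\<xi>} else {\<xi><..<1})"

definition Omega :: "real \<Rightarrow> nat \<Rightarrow> complex set" where
  "Omega \<xi> j = {z. cmod z \<in> tau \<xi> j}"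

definition JJ :: "real \<Rightarrow> (nat \<times> real) set" where
  "JJ \<xi> = {(1, \<xi>), (2, \<xi>), (2, 1)}"

definition refractive_index :: "real \<Rightarrow> (real \<Rightarrow> real) \<Rightarrow> bool" where
  "refractive_index \<xi> n \<longleftrightarrow>
     bdd_below (n ` {0<..<1}) \<and> 0 < Inf (n ` {0<..<1}) \<and> bdd_above (n ` {0<..<1}) \<and>
     (\<forall>j\<in>{1, 2}. (\<forall>i. \<forall>r\<in>tau \<xi> j. (deriv ^^ i) n differentiable at r) \<and>
        (\<exists>C. C-lipschitz_on (tau \<xi> j) n))"

definition mode :: "int \<Rightarrow> (real \<Rightarrow> complex) \<Rightarrow> complex \<Rightarrow> complex" where
  "mode m f z = f (cmod z) * cis (of_int m * Arg z)"

definition Lop :: "(real \<Rightarrow> real) \<Rightarrow> complex \<Rightarrow> int \<Rightarrow> (real \<Rightarrow> complex) \<Rightarrow> real \<Rightarrow> complex" where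
  "Lop n k m v r =
     - (1 / of_real r) *
         vector_derivative (\<lambda>s. of_real s * vector_derivative v (at s)) (at r)
     + ((of_int m)\<^sup>2 / (of_real r)\<^sup>2 - (k * of_real (n r))\<^sup>2) * v r"

text \<open>As \<open>n\<close> is smooth in \<open>tau \<xi> j\<close>, weak solutions are classical there, so the equation is
  required pointwise for twice differentiable functions.\<close>

definition radial_solution ::
    "real \<Rightarrow> (real \<Rightarrow> real) \<Rightarrow> nat \<Rightarrow> complex \<Rightarrow> int \<Rightarrow> (real \<Rightarrow> complex) \<Rightarrow> bool" where
  "radial_solution \<xi> n j k m f \<longleftrightarrow>
     mode m f \<in> H1 (Omega \<xi> j) \<and>
     (\<forall>r\<in>tau \<xi> j. f differentiable at r \<and> (\<lambda>s. vector_derivative f (at s)) differentiable at r \<and>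
        Lop n k m f r = 0)"

text \<open>Values of functions and of their derivatives at an end point of the open interval are
  one-sided limits (they exist for solutions, \<open>n\<close> being Lipschitz up to the end points);
  \<open>F\<close> is the corresponding one-sided filter.\<close>

definition end_values :: "real filter \<Rightarrow> (real \<Rightarrow> complex) \<Rightarrow> complex \<Rightarrow> complex \<Rightarrow> bool" where
  "end_values F f a b \<longleftrightarrow>
     (f \<longlongrightarrow> a) F \<and> ((\<lambda>r. vector_derivative f (at r)) \<longlongrightarrow> b) F"

definition origin_condition :: "int \<Rightarrow> (real \<Rightarrow> complex) \<Rightarrow> bool" where
  "origin_condition m f \<longleftrightarrow>
     (if odd m then (f \<longlongrightarrow> 0) (at_right 0)
      else ((\<lambda>r. vector_derivative f (at r)) \<longlongrightarrow> 0) (at_right 0))"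

type_synonym coeffs = "nat \<Rightarrow> complex \<Rightarrow> int \<Rightarrow> real \<Rightarrow> complex"

definition P11 :: "real \<Rightarrow> (real \<Rightarrow> real) \<Rightarrow> coeffs \<Rightarrow> complex \<Rightarrow> int \<Rightarrow> complex \<Rightarrow>
    (real \<Rightarrow> complex) \<Rightarrow> bool" where
  "P11 \<xi> n \<beta> k m h f \<longleftrightarrow>
     radial_solution \<xi> n 1 k m f \<and> origin_condition m f \<and>
     (\<exists>a b. end_values (at_left \<xi>) f a b \<and> b - \<beta> 1 k m \<xi> * a = h)"

definition P21 :: "real \<Rightarrow> (real \<Rightarrow> real) \<Rightarrow> coeffs \<Rightarrow> complex \<Rightarrow> int \<Rightarrow> complex \<Rightarrow>
    (real \<Rightarrow> complex) \<Rightarrow> bool" where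
  "P21 \<xi> n \<beta> k m h f \<longleftrightarrow>
     radial_solution \<xi> n 2 k m f \<and>
     (\<exists>a b. end_values (at_right \<xi>) f a b \<and> - b - \<beta> 2 k m \<xi> * a = 0) \<and>
     (\<exists>a b. end_values (at_left 1) f a b \<and> b - \<beta> 2 k m 1 * a = h)"

definition P22 :: "real \<Rightarrow> (real \<Rightarrow> real) \<Rightarrow> coeffs \<Rightarrow> complex \<Rightarrow> int \<Rightarrow> complex \<Rightarrow>
    (real \<Rightarrow> complex) \<Rightarrow> bool" where
  "P22 \<xi> n \<beta> k m h f \<longleftrightarrow>
     radial_solution \<xi> n 2 k m f \<and>
     (\<exists>a b. end_values (at_right \<xi>) f a b \<and> - b - \<beta> 2 k m \<xi> * a = h) \<and>
     (\<exists>a b. end_values (at_left 1) f a b \<and> b - \<beta> 2 k m 1 * a = 0)"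

text \<open>\<open>P m g f\<close> says that \<open>f\<close> solves the \<open>m\<close>-th problem with datum \<open>g\<close>, and \<open>h m\<close> are the given
  data. Solutions are functions on \<open>tau \<xi> j\<close>, so uniqueness is equality there. Continuous
  dependence: the solution operator is defined for every datum in \<open>complex\<close> and continuous
  with respect to the \<open>H\<^sup>1\<close> norm, separately for every \<open>m\<close>.\<close>

definition well_posed :: "real \<Rightarrow> nat \<Rightarrow> (int \<Rightarrow> complex \<Rightarrow> (real \<Rightarrow> complex) \<Rightarrow> bool) \<Rightarrow>
    (int \<Rightarrow> complex) \<Rightarrow> bool" where
  "well_posed \<xi> j P h \<longleftrightarrow> (\<forall>m.
     (\<exists>f. P m (h m) f \<and> (\<forall>f'. P m (h m) f' \<longrightarrow> (\<forall>r\<in>tau \<xi> j. f' r = f r))) \<and>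
     (\<exists>S. (\<forall>g. P m g (S g)) \<and>
       (\<forall>g0. ((\<lambda>g. H1_norm (Omega \<xi> j) (mode m (\<lambda>r. S g r - S g0 r))) \<longlongrightarrow> 0) (at g0))))"

end

theory Submission
  imports Defs
begin

text \<open>
  Testing the sign hypotheses with the functions \<open>cis (m * \<theta>)\<close> turns them into sign conditions on
  the single coefficients: for a suitable complex \<open>\<gamma>\<close> one has \<open>Re \<gamma> \<le> 0\<close>, \<open>Re (\<gamma> * k\<^sup>2) \<ge> 0\<close> and
  \<open>Re (\<gamma> * \<beta>) > 0\<close> for all \<open>\<beta>\<close>. For a solution \<open>f\<close> of the homogeneous equation with flux
  \<open>p = r * f'\<close> the function \<open>Re (\<gamma> * p * cnj f)\<close> is then nonincreasing. Under homogeneous boundary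
  conditions its limit at the left end is at most \<open>0\<close> and its limit at the right end is a positive
  multiple of \<open>\<bar>f\<bar>\<^sup>2\<close> there, so the Cauchy data at the right end vanish and \<open>f = 0\<close>.

  For existence write \<open>f = r ^ M * g\<close> with \<open>M = \<bar>m\<bar>\<close>. The equation becomes
  \<open>(r ^ (2 * M + 1) * g')' = - (k * n)\<^sup>2 * r ^ (2 * M + 1) * g\<close>, which is equivalent to a Volterra
  equation with bounded kernel, also when the interval starts at the singular point \<open>0\<close>. Moreover
  \<open>f * cis (m * \<theta>)\<close> is \<open>g\<close> times the \<open>M\<close>-th power of \<open>z\<close> or \<open>cnj z\<close>, hence in \<open>H\<^sup>1\<close>. Uniqueness
  makes the coefficient matrix of the boundary conditions regular.
\<close>

section \<open>Classical derivatives are weak derivatives\<close>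

text \<open>For real \<open>k\<close> the energy has no coercivity: off the imaginary axis the
  multiplier is \<open>\<i>\<close> or \<open>-\<i>\<close>, and then the real part of the energy
  derivative is a multiple of Im k, which vanishes for real \<open>k\<close>. Monotonicity can
  therefore yield only a vanishing trace at the right end; the rest is unique continuation backwards
  from there. The two sign hypotheses cover different \<open>k\<close>. Off the imaginary axis the
  condition on imaginary parts is used and Re (\<gamma> k^2) = 2 \<bar>Im k\<bar> \<bar>Re k\<bar>;
  on the axis the condition on real parts is used with \<gamma> = -1 and Re (\<gamma> k^2) = (Im
  k)^2. At the origin the prescribed condition controls only \<open>f\<close> or only
  \<open>f'\<close>, depending on the parity of \<open>m\<close>, whereas monotonicity needs the
  limit of \<open>p * cnj f\<close>; each parity has its own argument for the limit 0. The exponent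
  M is the nonnegative root of the indicial equation at 0. The weight r^(2M+1) brings the equation
  for \<open>g\<close> into divergence form and absorbs the singular term m^2 / r^2, so what remains
  on the right-hand side is a bounded coefficient.\<close>

lemma compact_continuous_norm_bound:
  fixes f :: "'a::topological_space \<Rightarrow> 'b::real_normed_vector"
  assumes "compact S" "continuous_on S f"
  obtains B where "0 \<le> B" "\<And>x. x \<in> S \<Longrightarrow> norm (f x) \<le> B"
proof -
  obtain B where "0 < B" "\<forall>x\<in>f ` S. norm x \<le> B"
    using compact_imp_bounded[OF compact_continuous_image[OF assms(2,1)]] bounded_pos by blast
  with that[of B] show thesis by auto
qed

text \<open>By translation invariance the difference quotients of \<open>\<psi>\<close> in direction \<open>b\<close> have integral
  \<open>0\<close>; dominated convergence passes to the derivative.\<close>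

lemma integral_directional_derivative_eq_0:
  fixes \<psi> :: "'a::euclidean_space \<Rightarrow> complex"
  assumes der: "\<And>x. (\<psi> has_derivative \<psi>' x) (at x)"
    and supp: "\<And>x. x \<notin> K \<Longrightarrow> \<psi> x = 0" and K: "bounded K"
    and bnd: "\<And>x. norm (\<psi>' x b) \<le> B"
  shows "(LINT x|lborel. \<psi>' x b) = 0"
proof -
  obtain R where R: "\<And>x. x \<in> K \<Longrightarrow> norm x \<le> R"
    using K unfolding bounded_iff by blast
  define C where "C = cball (0::'a) (R + norm b)"
  have cont: "continuous_on UNIV \<psi>"
    using der by (meson continuous_at_imp_continuous_on has_derivative_continuous)
  hence meas [measurable]: "\<psi> \<in> borel_measurable borel"
    by (rule borel_measurable_continuous_onI)
  have int: "integrable lborel \<psi>"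
  proof -
    have "integrable lborel (\<lambda>x. indicator C x *\<^sub>R \<psi> x)"
      unfolding C_def by (intro borel_integrable_compact continuous_on_subset[OF cont]) auto
    also have "(\<lambda>x. indicator C x *\<^sub>R \<psi> x) = \<psi>"
    proof
      fix x
      show "indicator C x *\<^sub>R \<psi> x = \<psi> x"
        using R[of x] supp[of x] norm_ge_zero[of b]
        by (cases "x \<in> K") (auto simp: C_def indicator_def simp del: norm_ge_zero)
    qed
    finally show ?thesis .
  qed
  define t where "t = (\<lambda>i. inverse (real (Suc i)))"
  have t: "0 < t i" "t i \<le> 1" for i
    unfolding t_def by (auto simp: field_simps)
  define s where "s = (\<lambda>i x. (\<psi> (t i *\<^sub>R b + x) - \<psi> x) /\<^sub>R t i)"
  have trans: "integrable lborel (\<lambda>x. \<psi> (c + x))" "(LINT x|lborel. \<psi> (c + x)) = (LINT x|lborel. \<psi> x)" for c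
  proof -
    have *: "distr lborel borel ((+) c) = lborel" by (rule lborel_distr_plus)
    show "integrable lborel (\<lambda>x. \<psi> (c + x))"
      using int integrable_distr_eq[of "(+) c" lborel borel \<psi>] by (simp add: *)
    show "(LINT x|lborel. \<psi> (c + x)) = (LINT x|lborel. \<psi> x)"
      using integral_distr[of "(+) c" lborel borel \<psi>] by (simp add: *)
  qed
  have s0: "(LINT x|lborel. s i x) = 0" for i
    unfolding s_def using trans int by simp
  have lim: "(\<lambda>i. s i x) \<longlonglongrightarrow> \<psi>' x b" for x
  proof -
    have "((\<lambda>h. \<psi> (h *\<^sub>R b + x)) has_vector_derivative \<psi>' x b) (at 0)"
    proof -
      have "((\<lambda>h. \<psi> (h *\<^sub>R b + x)) has_derivative (\<lambda>h. \<psi>' x (h *\<^sub>R b))) (at 0)"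
        by (rule has_derivative_compose[of "\<lambda>h. h *\<^sub>R b + x" "\<lambda>h. h *\<^sub>R b" 0 UNIV \<psi> "\<psi>' x"])
           (auto intro!: derivative_eq_intros simp: der)
      thus ?thesis
        by (simp add: has_vector_derivative_def linear_simps(5)[OF has_derivative_bounded_linear[OF der]])
    qed
    hence "((\<lambda>h. norm (\<psi> (h *\<^sub>R b + x) - \<psi> x - h *\<^sub>R \<psi>' x b) / norm h) \<longlongrightarrow> 0) (at 0)"
      unfolding has_vector_derivative_def has_derivative_at by simp
    hence "((\<lambda>h. norm ((\<psi> (h *\<^sub>R b + x) - \<psi> x) /\<^sub>R h - \<psi>' x b)) \<longlongrightarrow> 0) (at 0)"
    proof (rule Lim_transform_eventually)
      have "norm (y - h *\<^sub>R z) / norm h = norm (y /\<^sub>R h - z)" if "h \<noteq> 0" for y z :: complex and h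
      proof -
        have "y /\<^sub>R h - z = (y - h *\<^sub>R z) /\<^sub>R h" using that by (simp add: scaleR_diff_right)
        thus ?thesis by (simp add: divide_inverse mult.commute)
      qed
      thus "\<forall>\<^sub>F h in at 0. norm (\<psi> (h *\<^sub>R b + x) - \<psi> x - h *\<^sub>R \<psi>' x b) / norm h =
          norm ((\<psi> (h *\<^sub>R b + x) - \<psi> x) /\<^sub>R h - \<psi>' x b)"
        by (simp add: eventually_at_filter)
    qed
    hence "((\<lambda>h. (\<psi> (h *\<^sub>R b + x) - \<psi> x) /\<^sub>R h) \<longlongrightarrow> \<psi>' x b) (at 0)"
      by (subst LIM_zero_iff [symmetric], subst tendsto_norm_zero_iff [symmetric])
    moreover have "filterlim t (at 0) sequentially"
      unfolding filterlim_at t_def using LIMSEQ_inverse_real_of_nat by auto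
    ultimately show ?thesis unfolding s_def by (rule filterlim_compose)
  qed
  have B0: "0 \<le> B" using bnd[of 0] norm_ge_zero order_trans by blast
  \<comment> \<open>The mean value inequality along the line in direction \<open>b\<close> turns the
    bound on this one directional derivative into a bound on every difference quotient, which
    supplies the dominating function.\<close>
  have lip: "norm (\<psi> (h *\<^sub>R b + x) - \<psi> x) \<le> B * h" if "0 < h" for h x
  proof -
    have "norm (\<psi> (h *\<^sub>R b + x) - \<psi> (0 *\<^sub>R b + x)) \<le> B * norm (h - 0)"
    proof (rule differentiable_bound[where S = UNIV and f = "\<lambda>h. \<psi> (h *\<^sub>R b + x)" and f' = "\<lambda>h k. k *\<^sub>R \<psi>' (h *\<^sub>R b + x) b"])
      show "((\<lambda>h. \<psi> (h *\<^sub>R b + x)) has_derivative (\<lambda>k. k *\<^sub>R \<psi>' (h *\<^sub>R b + x) b)) (at h within UNIV)" for h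
      proof -
        have "((\<lambda>h. \<psi> (h *\<^sub>R b + x)) has_derivative (\<lambda>k. \<psi>' (h *\<^sub>R b + x) (k *\<^sub>R b))) (at h)"
          by (rule has_derivative_compose[of "\<lambda>h. h *\<^sub>R b + x" "\<lambda>h. h *\<^sub>R b" h UNIV \<psi> "\<psi>' (h *\<^sub>R b + x)"])
             (auto intro!: derivative_eq_intros simp: der)
        thus ?thesis
          by (simp add: linear_simps(5)[OF has_derivative_bounded_linear[OF der]])
      qed
      show "onorm (\<lambda>k. k *\<^sub>R \<psi>' (h *\<^sub>R b + x) b) \<le> B" for h
      proof (rule onorm_bound[OF B0])
        show "norm (k *\<^sub>R \<psi>' (h *\<^sub>R b + x) b) \<le> B * norm k" for k
          using mult_right_mono[OF bnd, of "norm k"] by (simp add: mult.commute)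
      qed
    qed auto
    thus ?thesis using that by simp
  qed
  have bound: "norm (s i x) \<le> B * indicator C x" for i x
  proof (cases "x \<in> C")
    case True
    have "norm (s i x) = norm (\<psi> (t i *\<^sub>R b + x) - \<psi> x) / t i"
      unfolding s_def using t(1)[of i] by (simp add: divide_inverse mult.commute)
    also have "\<dots> \<le> B" using lip[OF t(1)[of i], of x] t(1)[of i] by (simp add: field_simps)
    finally show ?thesis using True by simp
  next
    case False
    hence x: "norm x > R + norm b" by (simp add: C_def)
    hence 1: "x \<notin> K" using R[of x] norm_ge_zero[of b] by linarith
    have "norm (t i *\<^sub>R b) \<le> norm b" using t[of i] by (simp add: mult_left_le_one_le)
    moreover have "norm x \<le> norm (t i *\<^sub>R b + x) + norm (t i *\<^sub>R b)"
      using norm_triangle_ineq4[of "t i *\<^sub>R b + x" "t i *\<^sub>R b"] by simp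
    ultimately have 2: "t i *\<^sub>R b + x \<notin> K" using x R[of "t i *\<^sub>R b + x"] by fastforce
    show ?thesis using 1 2 False by (simp add: s_def supp)
  qed
  have [measurable]: "s i \<in> borel_measurable lborel" for i
    unfolding s_def by measurable
  have meas': "(\<lambda>x. \<psi>' x b) \<in> borel_measurable lborel"
    by (rule borel_measurable_LIMSEQ_metric[OF _ lim]) measurable
  have "(\<lambda>i. LINT x|lborel. s i x) \<longlonglongrightarrow> (LINT x|lborel. \<psi>' x b)"
  proof (rule integral_dominated_convergence[where w = "\<lambda>x. B * indicator C x"])
    show "integrable lborel (\<lambda>x. B * indicator C x)"
      unfolding C_def
      by (intro integrable_mult_right integrable_real_indicator)
         (use emeasure_bounded_finite[OF bounded_cball] in auto)
  qed (use meas' lim bound in auto)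
  thus ?thesis by (simp add: s0 LIMSEQ_const_iff)
qed

text \<open>A bounded set has finite measure, so a bounded continuous function is integrable with
  all its powers. The second claim stays on \<open>lborel\<close>, where the translation argument
  runs; completion carries integrals over to \<open>lebesgue\<close>.\<close>

lemma bounded_continuous_L2_on:
  fixes u :: "'a::euclidean_space \<Rightarrow> complex"
  assumes A: "open A" "bounded A" and u: "continuous_on A u" and bnd: "\<And>z. z \<in> A \<Longrightarrow> norm (u z) \<le> B"
  shows "L2_on A u" and "set_integrable lborel A u"
proof -
  have Am [measurable]: "A \<in> sets borel" using A by auto
  have fin: "emeasure lborel A < \<infinity>" using A by (intro emeasure_bounded_finite) auto
  have m [measurable]: "(\<lambda>x. indicator A x *\<^sub>R u x) \<in> borel_measurable borel"
    using borel_measurable_continuous_on_indicator[OF Am u] .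
  show "set_integrable lborel A u"
    unfolding set_integrable_def
  proof (rule integrableI_bounded_set[where A = A and B = B])
    show "(\<lambda>x. indicator A x *\<^sub>R u x) \<in> borel_measurable lborel" using m by simp
  qed (use fin bnd in auto)
  have m2: "(\<lambda>x. indicator A x *\<^sub>R (cmod (u x))\<^sup>2) \<in> borel_measurable borel"
    by (intro borel_measurable_continuous_on_indicator Am continuous_intros u)
  have "integrable lborel (\<lambda>x. indicator A x *\<^sub>R (cmod (u x))\<^sup>2)"
  proof (rule integrableI_bounded_set[where A = A and B = "B\<^sup>2"])
    show "(\<lambda>x. indicator A x *\<^sub>R (cmod (u x))\<^sup>2) \<in> borel_measurable lborel" using m2 by simp
  qed (use fin bnd in \<open>auto intro!: power_mono\<close>)
  hence "integrable lebesgue (\<lambda>x. indicator A x *\<^sub>R (cmod (u x))\<^sup>2)"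
    using m2 by (subst integrable_completion) auto
  thus "L2_on A u"
    unfolding L2_on_def set_borel_measurable_def set_integrable_def
    using m by (auto intro: measurable_completion)
qed

text \<open>Integration by parts without boundary term: \<phi> u has a derivative with integral 0,
  and the product rule splits this integral into the two sides of the weak identity. The bound
  \<open>B\<close> ensures that both parts are integrable and that \<open>u' z b\<close> is in
  L^2.\<close>

lemma classical_imp_weak_gradient:
  fixes u :: "'a::euclidean_space \<Rightarrow> complex"
  assumes A: "open A" "bounded A"
    and der: "\<And>z. z \<in> A \<Longrightarrow> (u has_derivative u' z) (at z)"
    and cont: "\<And>b. b \<in> Basis \<Longrightarrow> continuous_on A (\<lambda>z. u' z b)"
    and B0: "0 \<le> B" and bnd: "\<And>z. z \<in> A \<Longrightarrow> norm (u z) \<le> B" "\<And>z b. z \<in> A \<Longrightarrow> b \<in> Basis \<Longrightarrow> norm (u' z b) \<le> B"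
  shows "weak_gradient A u (\<lambda>b z. u' z b)"
  unfolding weak_gradient_def weak_partial_def
proof (intro ballI conjI allI impI)
  fix b :: 'a assume b: "b \<in> Basis"
  show "L2_on A (\<lambda>z. u' z b)"
    using bounded_continuous_L2_on[OF A cont[OF b]] bnd b by blast
  fix \<phi> :: "'a \<Rightarrow> real"
  assume test: "test_function A \<phi>"
  define K where "K = closure {x. \<phi> x \<noteq> 0}"
  have K: "compact K" "K \<subseteq> A" and Ck: "Ck (Suc 0) \<phi>"
    using test by (auto simp: test_function_def K_def simp del: Ck.simps)
  have supp: "\<phi> x = 0" if "x \<notin> K" for x
    using that closure_subset[of "{x. \<phi> x \<noteq> 0}"] by (auto simp: K_def)
  define \<phi>' where "\<phi>' = (\<lambda>x. frechet_derivative \<phi> (at x))"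
  have d\<phi>: "(\<phi> has_derivative \<phi>' x) (at x)" for x
    using Ck by (simp add: \<phi>'_def frechet_derivative_works)
  have c\<phi>': "continuous_on UNIV (\<lambda>x. \<phi>' x b)"
    using Ck b by (simp add: \<phi>'_def)
  have c\<phi>: "continuous_on UNIV \<phi>"
    using d\<phi> by (meson continuous_at_imp_continuous_on has_derivative_continuous)
  have supp': "\<phi>' x = (\<lambda>_. 0)" if "x \<notin> K" for x
  proof -
    have "(\<phi> has_derivative (\<lambda>_. 0)) (at x)"
    proof (rule has_derivative_transform_within_open)
      show "((\<lambda>_. 0) has_derivative (\<lambda>_. 0)) (at x)" by simp
      show "open (- K)" unfolding K_def by auto
      show "x \<in> - K" using that by simp
    qed (use supp in auto)
    thus ?thesis using d\<phi> has_derivative_unique by blast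
  qed
  obtain C0 where C0: "norm (\<phi> x) \<le> C0" if "x \<in> K" for x
    using compact_continuous_norm_bound[OF K(1) continuous_on_subset[OF c\<phi>]] by blast
  obtain C1 where C1: "norm (\<phi>' x b) \<le> C1" if "x \<in> K" for x
    using compact_continuous_norm_bound[OF K(1) continuous_on_subset[OF c\<phi>']] by blast
  define C where "C = max 0 (max C0 C1)"
  have C: "norm (\<phi> x) \<le> C" "norm (\<phi>' x b) \<le> C" for x
    using C0[of x] C1[of x] supp[of x] supp'[of x] by (cases "x \<in> K"; force simp: C_def)+
  \<comment> \<open>Extension by 0 stays differentiable across the boundary of \<open>A\<close>:
    every point outside \<open>A\<close> lies in the open complement of the compact support
    \<open>K\<close>, where the product vanishes.\<close>
  define \<psi> where "\<psi> = (\<lambda>x. if x \<in> A then \<phi> x *\<^sub>R u x else 0)"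
  define \<psi>' where "\<psi>' = (\<lambda>x h. if x \<in> A then \<phi> x *\<^sub>R u' x h + \<phi>' x h *\<^sub>R u x else 0)"
  have "(LINT x|lborel. \<psi>' x b) = 0"
  proof (rule integral_directional_derivative_eq_0)
    show "(\<psi> has_derivative \<psi>' x) (at x)" for x
    proof (cases "x \<in> A")
      case True
      have "((\<lambda>x. \<phi> x *\<^sub>R u x) has_derivative \<psi>' x) (at x)"
        using has_derivative_scaleR[OF d\<phi> der[OF True]] True by (simp add: \<psi>'_def)
      thus ?thesis
        by (rule has_derivative_transform_within_open[OF _ A(1) True]) (simp add: \<psi>_def)
    next
      case False
      have "((\<lambda>_. 0) has_derivative \<psi>' x) (at x)"
        using False by (simp add: \<psi>'_def)
      thus ?thesis
      proof (rule has_derivative_transform_within_open)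
        show "open (- K)" unfolding K_def by auto
        show "x \<in> - K" using False K by auto
      qed (use supp in \<open>auto simp: \<psi>_def\<close>)
    qed
    show "\<psi> x = 0" if "x \<notin> K" for x using supp[OF that] by (simp add: \<psi>_def)
    show "bounded K" using K compact_imp_bounded by blast
    show "norm (\<psi>' x b) \<le> C * B + C * B" for x
    proof (cases "x \<in> A")
      case True
      have "norm (\<psi>' x b) \<le> norm (\<phi> x *\<^sub>R u' x b) + norm (\<phi>' x b *\<^sub>R u x)"
        using True norm_triangle_ineq[of "\<phi> x *\<^sub>R u' x b" "\<phi>' x b *\<^sub>R u x"] by (simp add: \<psi>'_def)
      also have "\<dots> \<le> C * B + C * B"
        unfolding norm_scaleR using C[of x] bnd[OF True] b
        by (intro add_mono mult_mono) (auto simp: C_def)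
      finally show ?thesis .
    next
      case False
      thus ?thesis
        using B0 by (simp add: \<psi>'_def C_def)
    qed
  qed
  define f where "f = (\<lambda>x. \<phi>' x b *\<^sub>R u x)"
  define g where "g = (\<lambda>x. \<phi> x *\<^sub>R u' x b)"
  have cu: "continuous_on A u"
    using der by (meson continuous_at_imp_continuous_on has_derivative_continuous)
  have Cn: "0 \<le> C" by (simp add: C_def)
  have cf: "continuous_on A f" unfolding f_def
    by (intro continuous_intros cu continuous_on_subset[OF c\<phi>']) auto
  have cg: "continuous_on A g" unfolding g_def
    by (intro continuous_intros cont[OF b] continuous_on_subset[OF c\<phi>]) auto
  have f: "set_integrable lborel A f"
    using C(2) bnd Cn by (intro bounded_continuous_L2_on(2)[OF A cf, of "C * B"])
      (auto simp: f_def intro!: mult_mono)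
  have g: "set_integrable lborel A g"
    using C(1) bnd b Cn by (intro bounded_continuous_L2_on(2)[OF A cg, of "C * B"])
      (auto simp: g_def intro!: mult_mono)
  have "(LINT x:A|lborel. f x) + (LINT x:A|lborel. g x) = (LINT x:A|lborel. f x + g x)"
    using f g by (simp add: set_integral_add)
  also have "\<dots> = (LINT x|lborel. \<psi>' x b)"
    unfolding set_lebesgue_integral_def
    by (rule arg_cong[where f = "integral\<^sup>L lborel"]) (auto simp: \<psi>'_def f_def g_def fun_eq_iff)
  also have "\<dots> = 0" by fact
  finally have "(LINT x:A|lborel. f x) = - (LINT x:A|lborel. g x)" by (simp add: eq_neg_iff_add_eq_0)
  moreover have "(LINT x:A|lebesgue. f x) = (LINT x:A|lborel. f x)"
    using f unfolding set_lebesgue_integral_def set_integrable_def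
    by (intro integral_completion) auto
  moreover have "(LINT x:A|lebesgue. g x) = (LINT x:A|lborel. g x)"
    using g unfolding set_lebesgue_integral_def set_integrable_def
    by (intro integral_completion) auto
  ultimately show "(LINT x:A|lebesgue. frechet_derivative \<phi> (at x) b *\<^sub>R u x) =
      - (LINT x:A|lebesgue. \<phi> x *\<^sub>R u' x b)"
    by (simp add: f_def g_def \<phi>'_def)
qed

text \<open>\<open>Arg\<close> jumps on the negative real axis, so \<open>mode\<close> cannot be
  differentiated there in its defining form. By de Moivre r^M cis (m \<theta>) is a power of z or of
  its conjugate, which has no branch cut.\<close>

lemma mode_eq_power:
  assumes "f (cmod z) = of_real (cmod z) ^ nat \<bar>m\<bar> * g (cmod z)"
  shows "mode m f z = g (cmod z) * (if 0 \<le> m then z else cnj z) ^ nat \<bar>m\<bar>"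
proof -
  define \<sigma> where "\<sigma> = (if 0 \<le> m then z else cnj z)"
  have "\<sigma> = of_real (cmod z) * cis (if 0 \<le> m then Arg z else - Arg z)"
    using rcis_cmod_Arg[of z] by (auto simp: \<sigma>_def rcis_def simp flip: cis_cnj) (metis complex_cnj_complex_of_real complex_cnj_mult)
  hence "\<sigma> ^ nat \<bar>m\<bar> = of_real (cmod z) ^ nat \<bar>m\<bar> * cis (of_int m * Arg z)"
    by (simp add: power_mult_distrib Complex.DeMoivre)
  thus ?thesis by (simp add: mode_def assms \<sigma>_def)
qed

text \<open>The domain omits the origin even for \<open>c = 0\<close>, so \<open>cmod\<close> is
  differentiable on it and the chain rule applies. Continuity of \<open>g\<close> and
  \<open>dg\<close> up to the end points makes the function and its gradient bounded, and the domain
  is bounded.\<close>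

lemma mode_in_H1:
  fixes g dg :: "real \<Rightarrow> complex"
  assumes cd: "0 \<le> c" "c < d"
    and g: "continuous_on {c..d} g" and dg: "continuous_on {c..d} dg"
    and der: "\<And>r. r \<in> {c<..<d} \<Longrightarrow> (g has_vector_derivative dg r) (at r)"
    and f: "\<And>r. r \<in> {c<..<d} \<Longrightarrow> f r = of_real r ^ nat \<bar>m\<bar> * g r"
  shows "mode m f \<in> H1 {z. cmod z \<in> {c<..<d}}"
proof -
  define \<Omega> where "\<Omega> = {z. cmod z \<in> {c<..<d}}"
  define M where "M = nat \<bar>m\<bar>"
  define \<sigma> where "\<sigma> = (\<lambda>z. if 0 \<le> m then z else cnj z)"
  have \<sigma>: "bounded_linear \<sigma>"
    unfolding \<sigma>_def by (cases "0 \<le> m") (simp_all add: bounded_linear_cnj bounded_linear_ident)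
  have \<sigma>n: "cmod (\<sigma> z) = cmod z" for z by (simp add: \<sigma>_def)
  \<comment> \<open>Product rule for \<open>g (cmod z) * \<sigma> z ^ M\<close>:
    \<open>h \<bullet> sgn z\<close> is the derivative of \<open>cmod\<close> in direction h. For M
    = 0 the truncated exponent \<open>M - 1\<close> is harmless because of the factor
    \<open>of_nat M\<close>.\<close>
  define u' where "u' = (\<lambda>z h. of_real (h \<bullet> sgn z) * dg (cmod z) * \<sigma> z ^ M
      + g (cmod z) * (of_nat M * \<sigma> h * \<sigma> z ^ (M - 1)))"
  have op: "open \<Omega>"
  proof -
    have "\<Omega> = cmod -` {c<..<d}" by (auto simp: \<Omega>_def)
    thus ?thesis by (simp add: open_vimage continuous_on_norm_id)
  qed
  have bdd: "bounded \<Omega>" by (rule boundedI[where B = d]) (auto simp: \<Omega>_def)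
  have nz: "z \<noteq> 0" if "z \<in> \<Omega>" for z using that cd by (auto simp: \<Omega>_def)
  have eq: "mode m f z = g (cmod z) * \<sigma> z ^ M" if "z \<in> \<Omega>" for z
    using that mode_eq_power[of f z m g] f by (auto simp: \<Omega>_def \<sigma>_def M_def)
  have D: "(mode m f has_derivative u' z) (at z)" if z: "z \<in> \<Omega>" for z
  proof -
    have 1: "((\<lambda>z. g (cmod z)) has_derivative (\<lambda>h. (h \<bullet> sgn z) *\<^sub>R dg (cmod z))) (at z)"
      using has_derivative_compose[OF has_derivative_norm[OF nz[OF z]]
          der[of "cmod z", unfolded has_vector_derivative_def]] z
      by (simp add: \<Omega>_def inner_commute)
    have 2: "((\<lambda>z. \<sigma> z ^ M) has_derivative (\<lambda>h. of_nat M * \<sigma> h * \<sigma> z ^ (M - 1))) (at z)"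
      by (rule has_derivative_eq_rhs[OF has_derivative_power[OF bounded_linear_imp_has_derivative[OF \<sigma>]]]) 
         (simp add: mult_ac)
    have "((\<lambda>z. g (cmod z) * \<sigma> z ^ M) has_derivative u' z) (at z)"
      by (rule has_derivative_eq_rhs[OF has_derivative_mult[OF 1 2]])
         (simp add: u'_def fun_eq_iff scaleR_conv_of_real)
    thus ?thesis
      by (rule has_derivative_transform_within_open[OF _ op z]) (simp add: eq)
  qed
  have cont_comp: "continuous_on \<Omega> (\<lambda>z. k (cmod z))" if "continuous_on {c..d} k" for k :: "real \<Rightarrow> complex"
    by (rule continuous_on_compose2[OF that]) (auto intro!: continuous_intros simp: \<Omega>_def)
  have cont: "continuous_on \<Omega> (\<lambda>z. u' z b)" for b
    unfolding u'_def
    by (intro continuous_intros cont_comp g dg bounded_linear.continuous_on[OF \<sigma>])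
       (use nz in \<open>auto simp: sgn_div_norm intro!: continuous_intros\<close>)
  obtain B1 where B1: "cmod (g r) \<le> B1" if "r \<in> {c..d}" for r
    using compact_continuous_norm_bound[OF compact_Icc g] by blast
  obtain B2 where B2: "cmod (dg r) \<le> B2" if "r \<in> {c..d}" for r
    using compact_continuous_norm_bound[OF compact_Icc dg] by blast
  have B1p: "0 \<le> B1" and B2p: "0 \<le> B2"
    using B1[of c] B2[of c] cd norm_ge_zero[of "g c"] norm_ge_zero[of "dg c"]
    by (auto simp del: norm_ge_zero intro: order_trans)
  define B where "B = B2 * d ^ M + B1 * (M * d ^ (M - 1)) + B1 * d ^ M"
  have nb: "cmod (mode m f z) \<le> B" if z: "z \<in> \<Omega>" for z
  proof -
    have "cmod (mode m f z) = cmod (g (cmod z)) * cmod z ^ M"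
      by (simp add: eq[OF z] norm_mult norm_power \<sigma>n)
    also have "\<dots> \<le> B1 * d ^ M"
      using z by (intro mult_mono B1 power_mono) (auto simp: \<Omega>_def B1p)
    also have "\<dots> \<le> B" using B1p B2p cd by (simp add: B_def)
    finally show ?thesis .
  qed
  have db: "cmod (u' z b) \<le> B" if z: "z \<in> \<Omega>" and b: "b \<in> Basis" for z b
  proof -
    have zd: "cmod z \<le> d" "cmod z \<in> {c..d}" using z by (auto simp: \<Omega>_def)
    have s1: "\<bar>b \<bullet> sgn z\<bar> \<le> 1"
      using Cauchy_Schwarz_ineq2[of b "sgn z"] nz[OF z] b by (simp add: norm_sgn)
    have "cmod (u' z b) \<le> cmod (of_real (b \<bullet> sgn z) * dg (cmod z) * \<sigma> z ^ M)
        + cmod (g (cmod z) * (of_nat M * \<sigma> b * \<sigma> z ^ (M - 1)))"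
      unfolding u'_def by (rule norm_triangle_ineq)
    also have "\<dots> = \<bar>b \<bullet> sgn z\<bar> * cmod (dg (cmod z)) * cmod z ^ M
        + cmod (g (cmod z)) * (M * cmod z ^ (M - 1))"
      using b by (simp add: norm_mult norm_power \<sigma>n)
    also have "\<dots> \<le> 1 * B2 * d ^ M + B1 * (M * d ^ (M - 1))"
      using zd by (intro add_mono mult_mono s1 B1 B2 power_mono) (auto simp: B1p B2p)
    also have "\<dots> \<le> B" using B1p cd by (simp add: B_def)
    finally show ?thesis .
  qed
  have B0: "0 \<le> B" using B1p B2p cd by (simp add: B_def)
  have "continuous_on \<Omega> (mode m f)"
    using D by (meson continuous_at_imp_continuous_on has_derivative_continuous)
  hence "L2_on \<Omega> (mode m f)"
    by (rule bounded_continuous_L2_on[OF op bdd]) (rule nb)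
  moreover have "weak_gradient \<Omega> (mode m f) (\<lambda>b z. u' z b)"
    by (rule classical_imp_weak_gradient[OF op bdd D cont B0 nb db])
  ultimately show ?thesis unfolding H1_def \<Omega>_def [symmetric] by blast
qed

section \<open>Scalar multiples in the H^1 norm\<close>

lemma L2_on_cmult:
  assumes "L2_on A u" shows "L2_on A (\<lambda>z. c * u z)"
proof -
  have "set_borel_measurable lebesgue A (\<lambda>z. c * u z)"
  proof -
    have "(\<lambda>x. c * (indicator A x *\<^sub>R u x)) \<in> borel_measurable lebesgue"
      using assms unfolding L2_on_def set_borel_measurable_def by (intro borel_measurable_times) auto
    thus ?thesis by (simp add: set_borel_measurable_def mult_scaleR_right)
  qed
  moreover have "set_integrable lebesgue A (\<lambda>x. (cmod (c * u x))\<^sup>2)"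
    unfolding norm_mult power_mult_distrib
    using assms unfolding L2_on_def by (intro set_integrable_mult_right) auto
  ultimately show ?thesis by (simp add: L2_on_def)
qed

lemma weak_gradient_cmult:
  assumes "weak_gradient A u G"
  shows "weak_gradient A (\<lambda>z. c * u z) (\<lambda>b z. c * G b z)"
  using assms unfolding weak_gradient_def weak_partial_def
  by (auto simp: L2_on_cmult simp flip: mult_scaleR_right)

text \<open>The scaled gradient \<open>c * G\<close> competes in the infimum that defines the norm
  of \<open>c * u\<close>, and its value is \<open>cmod c\<close> times a number independent of
  \<open>c\<close>. Continuity of the solution operators rests on this bound.\<close>

lemma H1_norm_cmult_bound:
  fixes u :: "'a::euclidean_space \<Rightarrow> complex"
  assumes "u \<in> H1 A"
  obtains K where "\<And>c. H1_norm A (\<lambda>z. c * u z) \<le> cmod c * K" "\<And>c. 0 \<le> H1_norm A (\<lambda>z. c * u z)"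
proof -
  obtain G where G: "weak_gradient A u G" using assms by (auto simp: H1_def)
  define N where "N = (\<lambda>(u :: 'a \<Rightarrow> complex) (G :: 'a \<Rightarrow> 'a \<Rightarrow> complex). sqrt ((LINT x:A|lebesgue. (cmod (u x))\<^sup>2)
       + (\<Sum>b\<in>Basis. LINT x:A|lebesgue. (cmod (G b x))\<^sup>2)))"
  have N0: "0 \<le> N v H" for v H
    unfolding N_def set_lebesgue_integral_def
    by (intro real_sqrt_ge_zero add_nonneg_nonneg sum_nonneg integral_nonneg_AE) auto
  have H1: "H1_norm A v = Inf {N v H | H. weak_gradient A v H}" for v
    unfolding H1_norm_def N_def ..
  have scale: "N (\<lambda>z. c * u z) (\<lambda>b z. c * G b z) = cmod c * N u G" for c
  proof -
    have "N (\<lambda>z. c * u z) (\<lambda>b z. c * G b z) = sqrt ((cmod c)\<^sup>2 * ((LINT x:A|lebesgue. (cmod (u x))\<^sup>2)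
       + (\<Sum>b\<in>Basis. LINT x:A|lebesgue. (cmod (G b x))\<^sup>2)))"
      unfolding N_def by (simp add: norm_mult power_mult_distrib sum_distrib_left distrib_left)
    thus ?thesis by (simp add: real_sqrt_mult N_def)
  qed
  show thesis
  proof (rule that[of "N u G"])
    show "H1_norm A (\<lambda>z. c * u z) \<le> cmod c * N u G" for c
      unfolding H1 scale [symmetric]
      by (rule cInf_lower) (use weak_gradient_cmult[OF G] N0 in \<open>auto intro!: bdd_belowI[where m = 0]\<close>)
    show "0 \<le> H1_norm A (\<lambda>z. c * u z)" for c
      unfolding H1 by (rule cInf_greatest) (use weak_gradient_cmult[OF G] N0 in auto)
  qed
qed

section \<open>A singular linear Volterra equation\<close>

text \<open>The setting is (r^N g')' = r^N Q g on the interval from \<open>c\<close> to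
  \<open>d\<close>, with a degenerate weight at the left end when \<open>c = 0\<close>. Dividing the
  integrated equation by r^N and integrating again gives a fixed point equation. It is later used
  with N = 2M + 1 and Q = -(k n)^2.\<close>

locale volterra =
  fixes c d C :: real and N :: nat and Q :: "real \<Rightarrow> complex"
  assumes cd: "0 \<le> c" "c < d" and N: "0 < N"
    and Q: "continuous_on {c..d} Q" and QC: "\<And>s. s \<in> {c..d} \<Longrightarrow> norm (Q s) \<le> C"
begin

text \<open>The kernel \<open>s ^ N / t ^ N\<close> is at most \<open>1\<close>. For \<open>c = 0\<close> the value at \<open>t = 0\<close> is \<open>0 / 0 = 0\<close>,
  which is also the limit.\<close>

definition inner_op :: "(real \<Rightarrow> complex) \<Rightarrow> real \<Rightarrow> complex" where
  "inner_op u t = integral {c..t} (\<lambda>s. of_real (s ^ N) * Q s * u s) / of_real (t ^ N)"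

definition vop :: "(real \<Rightarrow> complex) \<Rightarrow> real \<Rightarrow> complex" where
  "vop u r = integral {c..r} (inner_op u)"

lemma C_nonneg: "0 \<le> C"
  using order_trans[OF norm_ge_zero QC[of c]] cd by simp

lemma integrand_cont:
  assumes "continuous_on {c..d} u"
  shows "continuous_on {c..d} (\<lambda>s. of_real (s ^ N) * Q s * u s)"
  by (intro continuous_intros Q assms)

text \<open>Since s \<le> t, the weight s^N is at most t^N and the division cancels it. The
  remaining factor \<open>t - c\<close>, the length of the interval, is what gives continuity at a
  singular left end.\<close>

lemma inner_op_bound:
  assumes u: "continuous_on {c..d} u" and t: "t \<in> {c..d}" and B: "\<And>s. s \<in> {c..t} \<Longrightarrow> norm (u s) \<le> B"
  shows "norm (inner_op u t) \<le> C * B * (t - c)"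
proof (cases "t = 0")
  case True
  hence "inner_op u t = 0" using N by (simp add: inner_op_def zero_power)
  thus ?thesis using True t cd by simp
next
  case False
  hence t0: "0 < t" using t cd by auto
  have "norm (integral {c..t} (\<lambda>s. of_real (s ^ N) * Q s * u s)) \<le> (t ^ N * C * B) * (t - c)"
  proof (rule integral_bound)
    show "continuous_on {c..t} (\<lambda>s. of_real (s ^ N) * Q s * u s)"
      using t by (intro continuous_on_subset[OF integrand_cont[OF u]]) auto
    fix s assume s: "s \<in> {c..t}"
    show "norm (of_real (s ^ N) * Q s * u s) \<le> t ^ N * C * B"
      unfolding norm_mult
      using s t cd QC[of s] B[OF s] C_nonneg
      by (intro mult_mono) (auto simp: norm_power intro!: power_mono)
  qed (use t in auto)
  thus ?thesis
    using t0 by (simp add: inner_op_def norm_divide norm_power field_simps)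
qed

text \<open>The denominator vanishes only at t = 0, hence only for \<open>c = 0\<close> at the left
  end. There the bound linear in \<open>t - c\<close> squeezes the quotient to 0; elsewhere it is a
  quotient of continuous functions.\<close>

lemma inner_op_cont:
  assumes u: "continuous_on {c..d} u"
  shows "continuous_on {c..d} (inner_op u)"
  unfolding continuous_on_eq_continuous_within
proof
  fix t assume t: "t \<in> {c..d}"
  show "continuous (at t within {c..d}) (inner_op u)"
  proof (cases "t = 0")
    case True
    hence c0: "c = 0" using t cd by auto
    obtain B where B: "norm (u r) \<le> B" if "r \<in> {c..d}" for r
      using compact_continuous_norm_bound[OF compact_Icc u] by blast
    have "(inner_op u \<longlongrightarrow> 0) (at 0 within {c..d})"
    proof (rule Lim_null_comparison)
      show "\<forall>\<^sub>F t in at 0 within {c..d}. norm (inner_op u t) \<le> C * B * (t - c)"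
        unfolding eventually_at_filter using inner_op_bound[OF u] B by auto
      have "((\<lambda>t. C * B * (t - c)) \<longlongrightarrow> C * B * (0 - c)) (at 0 within {c..d})"
        by (intro tendsto_intros)
      thus "((\<lambda>t. C * B * (t - c)) \<longlongrightarrow> 0) (at 0 within {c..d})" by (simp add: c0)
    qed
    moreover have "inner_op u t = 0" using True N by (simp add: inner_op_def zero_power)
    ultimately show ?thesis using True by (simp add: continuous_within)
  next
    case False
    have "continuous_on {c..d} (\<lambda>t. integral {c..t} (\<lambda>s. of_real (s ^ N) * Q s * u s))"
      by (intro indefinite_integral_continuous_1 integrable_continuous_real integrand_cont u)
    thus ?thesis
      using t False unfolding inner_op_def continuous_on_eq_continuous_within
      by (intro continuous_intros) auto
  qed
qed

lemma inner_op_integrable: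
  assumes "continuous_on {c..d} u" "r \<in> {c..d}"
  shows "inner_op u integrable_on {c..r}"
  using assms by (intro integrable_continuous_real continuous_on_subset[OF inner_op_cont]) auto

lemma vop_cont:
  assumes "continuous_on {c..d} u" shows "continuous_on {c..d} (vop u)"
  unfolding vop_def
  by (intro indefinite_integral_continuous_1 integrable_continuous_real inner_op_cont assms)

text \<open>The outer integration raises the power of \<open>r - c\<close> by one and divides by
  \<open>Suc i\<close>; iteration thus produces a factorial. The extra factor \<open>t - c\<close>
  of the inner bound is simply estimated by \<open>d - c\<close>.\<close>

lemma vop_bound:
  assumes u: "continuous_on {c..d} u" and r: "r \<in> {c..d}"
    and B: "\<And>s. s \<in> {c..d} \<Longrightarrow> norm (u s) \<le> B * (s - c) ^ i" and B0: "0 \<le> B"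
  shows "norm (vop u r) \<le> C * (d - c) * B * (r - c) ^ Suc i / Suc i"
proof -
  have hi: "((\<lambda>t. C * (d - c) * B * (t - c) ^ i) has_integral
      (C * (d - c) * B * ((r - c) ^ Suc i / Suc i) - C * (d - c) * B * ((c - c) ^ Suc i / Suc i))) {c..r}"
  proof (rule fundamental_theorem_of_calculus)
    show "((\<lambda>t. C * (d - c) * B * ((t - c) ^ Suc i / Suc i)) has_vector_derivative
        C * (d - c) * B * (t - c) ^ i) (at t within {c..r})" for t
    proof -
      have "((\<lambda>t. C * (d - c) * B * ((t - c) ^ Suc i / Suc i)) has_real_derivative
          C * (d - c) * B * (of_nat (Suc i) * (1 * (t - c) ^ (Suc i - Suc 0)) / Suc i)) (at t within {c..r})"
        by (intro DERIV_cmult DERIV_cdivide DERIV_power) (auto intro!: derivative_eq_intros)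
      thus ?thesis
        by (simp add: has_real_derivative_iff_has_vector_derivative del: of_nat_Suc)
    qed
  qed (use r in auto)
  have "norm (vop u r) \<le> integral {c..r} (\<lambda>t. C * (d - c) * B * (t - c) ^ i)"
    unfolding vop_def
  proof (rule integral_norm_bound_integral)
    show "inner_op u integrable_on {c..r}" using inner_op_integrable[OF u r] .
    show "(\<lambda>t. C * (d - c) * B * (t - c) ^ i) integrable_on {c..r}" using hi by blast
    fix t assume t: "t \<in> {c..r}"
    have "norm (inner_op u t) \<le> C * (B * (t - c) ^ i) * (t - c)"
    proof (rule inner_op_bound[OF u])
      fix s assume s: "s \<in> {c..t}"
      have "norm (u s) \<le> B * (s - c) ^ i" using B s t r by auto
      also have "\<dots> \<le> B * (t - c) ^ i" using s B0 by (intro mult_left_mono power_mono) auto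
      finally show "norm (u s) \<le> B * (t - c) ^ i" .
    qed (use t r in auto)
    also have "\<dots> \<le> C * (B * (t - c) ^ i) * (d - c)"
      using t r B0 C_nonneg by (intro mult_left_mono) auto
    finally show "norm (inner_op u t) \<le> C * (d - c) * B * (t - c) ^ i" by (simp add: mult_ac)
  qed
  also have "\<dots> = C * (d - c) * B * (r - c) ^ Suc i / Suc i"
    using integral_unique[OF hi] by simp
  finally show ?thesis .
qed

lemma inner_op_add:
  assumes "continuous_on {c..d} u" "continuous_on {c..d} v" "t \<in> {c..d}"
  shows "inner_op (\<lambda>s. u s + v s) t = inner_op u t + inner_op v t"
proof -
  have "(\<lambda>s. of_real (s ^ N) * Q s * w s) integrable_on {c..t}" if "continuous_on {c..d} w" for w :: "real \<Rightarrow> complex"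
    using assms(3) by (intro integrable_continuous_real continuous_on_subset[OF integrand_cont[OF that]]) auto
  thus ?thesis using assms
    by (simp add: inner_op_def distrib_left integral_add add_divide_distrib)
qed

lemma vop_add:
  assumes "continuous_on {c..d} u" "continuous_on {c..d} v" "r \<in> {c..d}"
  shows "vop (\<lambda>s. u s + v s) r = vop u r + vop v r"
proof -
  have "vop (\<lambda>s. u s + v s) r = integral {c..r} (\<lambda>t. inner_op u t + inner_op v t)"
    unfolding vop_def using assms by (intro integral_cong inner_op_add) auto
  thus ?thesis using assms by (simp add: vop_def integral_add inner_op_integrable)
qed

lemma vop_sum:
  assumes "\<And>i::nat. continuous_on {c..d} (u i)" "r \<in> {c..d}"
  shows "vop (\<lambda>s. \<Sum>i<k. u i s) r = (\<Sum>i<k. vop (u i) r)"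
proof (induction k)
  case 0
  show ?case by (simp add: vop_def inner_op_def [abs_def])
next
  case (Suc k)
  thus ?case using assms by (simp add: vop_add continuous_on_sum)
qed

text \<open>The Neumann series of \<open>vop\<close> applied to \<phi> converges uniformly, since
  its i-th term is at most A (C (d - c)^2)^i / i!. So no smallness of the interval is
  involved.\<close>

lemma fixed_point:
  assumes \<phi>: "continuous_on {c..d} \<phi>"
  obtains g where "continuous_on {c..d} g" "\<And>r. r \<in> {c..d} \<Longrightarrow> g r = \<phi> r + vop g r"
proof -
  define G where "G = (\<lambda>i. (vop ^^ i) \<phi>)"
  have G0: "G 0 = \<phi>" by (simp add: G_def)
  have GS: "G (Suc i) = vop (G i)" for i by (simp add: G_def)
  have Gc: "continuous_on {c..d} (G i)" for i
  proof (induction i)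
    case 0 show ?case unfolding G0 by (rule \<phi>)
  next
    case (Suc i) show ?case unfolding GS by (rule vop_cont[OF Suc])
  qed
  obtain A where A: "norm (\<phi> r) \<le> A" if "r \<in> {c..d}" for r
    using compact_continuous_norm_bound[OF compact_Icc \<phi>] by blast
  have A0: "0 \<le> A" using order_trans[OF norm_ge_zero A[of c]] cd by simp
  have Gb: "norm (G i r) \<le> (A * (C * (d - c)) ^ i / fact i) * (r - c) ^ i" if "r \<in> {c..d}" for i r
    using that
  proof (induction i arbitrary: r)
    case 0
    thus ?case using A by (simp add: G0)
  next
    case (Suc i)
    have "norm (vop (G i) r) \<le> C * (d - c) * (A * (C * (d - c)) ^ i / fact i) * (r - c) ^ Suc i / Suc i"
      using Suc.prems Suc.IH A0 C_nonneg cd by (intro vop_bound Gc) auto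
    also have "\<dots> = (A * (C * (d - c)) ^ Suc i / fact (Suc i)) * (r - c) ^ Suc i"
      by (simp add: field_simps del: of_nat_Suc)
    finally show ?case by (simp only: GS)
  qed
  define M where "M = (\<lambda>i. A * ((C * (d - c) * (d - c)) ^ i / fact i))"
  have "norm (G i r) \<le> M i" if r: "r \<in> {c..d}" for i r
  proof -
    have "norm (G i r) \<le> (A * (C * (d - c)) ^ i / fact i) * (r - c) ^ i" by (rule Gb[OF r])
    also have "\<dots> \<le> (A * (C * (d - c)) ^ i / fact i) * (d - c) ^ i"
      using r A0 C_nonneg cd by (intro mult_left_mono power_mono) auto
    finally show ?thesis by (simp add: M_def power_mult_distrib mult_ac)
  qed
  moreover have "summable M"
    unfolding M_def using summable_exp[of "C * (d - c) * (d - c)"]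
    by (intro summable_mult) (simp add: field_simps)
  ultimately have lim: "uniform_limit {c..d} (\<lambda>k r. \<Sum>i<k. G i r) (\<lambda>r. \<Sum>i. G i r) sequentially"
    by (intro Weierstrass_m_test) auto
  define S where "S = (\<lambda>k r. \<Sum>i<k. G i r)"
  define g where "g = (\<lambda>r. \<Sum>i. G i r)"
  have lim: "uniform_limit {c..d} S g sequentially" using lim by (simp add: S_def g_def)
  have Sc: "continuous_on {c..d} (S k)" for k
    unfolding S_def by (intro continuous_on_sum Gc)
  have gc: "continuous_on {c..d} g"
    by (rule uniform_limit_theorem[OF _ lim]) (auto simp: Sc)
  have "g r = \<phi> r + vop g r" if r: "r \<in> {c..d}" for r
  proof (rule LIMSEQ_unique)
    show "(\<lambda>k. S (Suc k) r) \<longlonglongrightarrow> g r"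
      by (intro LIMSEQ_Suc tendsto_uniform_limitI[OF lim r])
    \<comment> \<open>The shift by one index is the recursion of the partial sums; letting k tend to
      infinity on both sides gives the fixed point equation.\<close>
    have eq: "S (Suc k) r = \<phi> r + vop (S k) r" for k
      unfolding S_def by (subst vop_sum[OF Gc r]) (simp add: sum.lessThan_Suc_shift G0 GS del: sum.lessThan_Suc)
    have "(\<lambda>k. vop (S k) r) \<longlonglongrightarrow> vop g r"
    proof (rule tendstoI)
      fix e :: real assume e: "0 < e"
      \<comment> \<open>The operator norm bound of \<open>vop\<close> from \<open>vop_bound\<close>
        with \<open>i = 0\<close>, plus 1: this makes D positive and the final estimate
        strict.\<close>
      define D where "D = C * (d - c) * (d - c) + 1"
      have D: "0 < D" using C_nonneg cd by (simp add: D_def add_nonneg_pos)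
      have "\<forall>\<^sub>F k in sequentially. \<forall>s\<in>{c..d}. dist (S k s) (g s) < e / D"
        using lim e D by (intro uniform_limitD) auto
      thus "\<forall>\<^sub>F k in sequentially. dist (vop (S k) r) (vop g r) < e"
      proof eventually_elim
        case (elim k)
        have "vop (\<lambda>s. g s + (S k s - g s)) r = vop g r + vop (\<lambda>s. S k s - g s) r"
          by (intro vop_add continuous_intros gc Sc r)
        hence "vop (S k) r - vop g r = vop (\<lambda>s. S k s - g s) r" by simp
        hence "dist (vop (S k) r) (vop g r) = norm (vop (\<lambda>s. S k s - g s) r)" by (simp add: dist_norm)
        also have "\<dots> \<le> C * (d - c) * (e / D) * (r - c) ^ Suc 0 / Suc 0"
          using elim e D by (intro vop_bound continuous_intros gc Sc r) (auto simp: dist_norm less_imp_le)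
        also have "\<dots> \<le> C * (d - c) * (e / D) * (d - c)"
          using r C_nonneg cd e D by (auto intro!: mult_left_mono divide_right_mono)
        also have "\<dots> = (C * (d - c) * (d - c)) / D * e" by simp
        also have "\<dots> < 1 * e" using e D by (intro mult_strict_right_mono) (auto simp: D_def)
        finally show ?case by simp
      qed
    qed
    thus "(\<lambda>k. S (Suc k) r) \<longlonglongrightarrow> \<phi> r + vop g r" unfolding eq by (intro tendsto_intros)
  qed
  with gc show thesis using that by blast
qed

text \<open>The two initial values enter through the solution of (r^N g')' = 0, which serves as the
  inhomogeneity of the Volterra equation. For \<open>c = 0\<close> the derivative at 0 is forced to
  be 0, which selects the regular solution.\<close>

lemma ivp:
  obtains g dg where "continuous_on {c..d} g" "continuous_on {c..d} dg"
    "\<And>r. r \<in> {c<..<d} \<Longrightarrow> (g has_vector_derivative dg r) (at r)"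
    "\<And>r. r \<in> {c<..<d} \<Longrightarrow>
      ((\<lambda>s. of_real (s ^ N) * dg s) has_vector_derivative of_real (r ^ N) * Q r * g r) (at r)"
    "g c = a" "dg c = (if c = 0 then 0 else b)"
proof -
  \<comment> \<open>Here t^N w(t) is the constant b c^N, so t^N \<open>dg\<close> t is that constant
    plus the integral inside \<open>inner_op\<close>. For \<open>c = 0\<close> the function is 0
    because N > 0.\<close>
  define w where "w = (\<lambda>t. b * of_real ((c / t) ^ N))"
  have w: "continuous_on {c..d} w"
  proof (cases "c = 0")
    case True
    thus ?thesis using N by (simp add: w_def)
  next
    case False
    thus ?thesis unfolding w_def using cd by (intro continuous_intros) auto
  qed
  define \<phi> where "\<phi> = (\<lambda>r. a + integral {c..r} w)"
  have "continuous_on {c..d} \<phi>" unfolding \<phi>_def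
    by (intro continuous_intros indefinite_integral_continuous_1 integrable_continuous_real w)
  then obtain g where g: "continuous_on {c..d} g" "\<And>r. r \<in> {c..d} \<Longrightarrow> g r = \<phi> r + vop g r"
    using fixed_point by blast
  define dg where "dg = (\<lambda>t. w t + inner_op g t)"
  have dgc: "continuous_on {c..d} dg" unfolding dg_def by (intro continuous_intros w inner_op_cont g)
  have gd: "(g has_vector_derivative dg r) (at r)" if r: "r \<in> {c<..<d}" for r
  proof -
    have "((\<lambda>r. \<phi> r + vop g r) has_vector_derivative (0 + w r + inner_op g r)) (at r within {c..d})"
      unfolding \<phi>_def vop_def using r
      by (intro has_vector_derivative_add has_vector_derivative_const
          integral_has_vector_derivative w inner_op_cont g) auto
    hence "((\<lambda>r. \<phi> r + vop g r) has_vector_derivative dg r) (at r)"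
      using r at_within_Icc_at[of c r d] by (simp add: dg_def)
    thus ?thesis
      by (rule has_vector_derivative_transform_within_open[where S = "{c<..<d}"]) (use r g in auto)
  qed
  have Pd: "((\<lambda>s. of_real (s ^ N) * dg s) has_vector_derivative of_real (r ^ N) * Q r * g r) (at r)"
    if r: "r \<in> {c<..<d}" for r
  proof -
    have "((\<lambda>r. b * of_real (c ^ N) + integral {c..r} (\<lambda>s. of_real (s ^ N) * Q s * g s)) has_vector_derivative
        (0 + of_real (r ^ N) * Q r * g r)) (at r within {c..d})"
      using r by (intro has_vector_derivative_add has_vector_derivative_const
          integral_has_vector_derivative integrand_cont g) auto
    hence "((\<lambda>r. b * of_real (c ^ N) + integral {c..r} (\<lambda>s. of_real (s ^ N) * Q s * g s)) has_vector_derivative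
        of_real (r ^ N) * Q r * g r) (at r)"
      using r at_within_Icc_at[of c r d] by simp
    thus ?thesis
      by (rule has_vector_derivative_transform_within_open[where S = "{c<..<d}"])
         (use r cd in \<open>auto simp: dg_def w_def inner_op_def field_simps power_divide\<close>)
  qed
  have "inner_op g c = 0" by (simp add: inner_op_def)
  moreover have "vop g c = 0" by (simp add: vop_def)
  ultimately have "g c = a" "dg c = (if c = 0 then 0 else b)"
    using g(2)[of c] cd N by (auto simp: \<phi>_def dg_def w_def)
  with g dgc gd Pd show thesis using that by blast
qed

end

section \<open>Uniqueness for the radial equation\<close>

text \<open>This is r (m^2 / r^2 - (k n)^2), the zero-order coefficient after multiplying the
  equation by r, so that it reads (r f')' = potential times f.\<close>

definition potential :: "(real \<Rightarrow> real) \<Rightarrow> complex \<Rightarrow> int \<Rightarrow> real \<Rightarrow> complex" where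
  "potential n k m r = (of_int m)\<^sup>2 / of_real r - (k * of_real (n r))\<^sup>2 * of_real r"

text \<open>The equation as a first order system for \<open>f\<close> and the flux \<open>p = r * f'\<close>.\<close>

definition flux_system ::
    "(real \<Rightarrow> real) \<Rightarrow> complex \<Rightarrow> int \<Rightarrow> real set \<Rightarrow> (real \<Rightarrow> complex) \<Rightarrow> (real \<Rightarrow> complex) \<Rightarrow> bool" where
  "flux_system n k m T f p \<longleftrightarrow> (\<forall>r\<in>T. (f has_vector_derivative p r / of_real r) (at r) \<and>
     (p has_vector_derivative potential n k m r * f r) (at r))"

lemma Lop_eq:
  assumes "r \<noteq> 0"
  shows "Lop n k m f r = (potential n k m r * f r
    - vector_derivative (\<lambda>s. of_real s * vector_derivative f (at s)) (at r)) / of_real r"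
  using assms by (simp add: Lop_def potential_def field_simps power2_eq_square)

lemma flux_systemI_Lop:
  assumes "T \<subseteq> {0<..}"
    and "\<And>r. r \<in> T \<Longrightarrow> f differentiable at r \<and>
      (\<lambda>s. vector_derivative f (at s)) differentiable at r \<and> Lop n k m f r = 0"
  shows "flux_system n k m T f (\<lambda>r. of_real r * vector_derivative f (at r))"
  unfolding flux_system_def
proof (intro ballI conjI)
  fix r assume r: "r \<in> T"
  have r0: "0 < r" using assms(1) r by auto
  show "(f has_vector_derivative of_real r * vector_derivative f (at r) / of_real r) (at r)"
    using assms(2)[OF r] r0 by (simp add: vector_derivative_works)
  let ?p = "\<lambda>s. complex_of_real s * vector_derivative f (at s)"
  have "?p differentiable at r"
    using assms(2)[OF r] by (intro differentiable_mult) auto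
  hence "(?p has_vector_derivative vector_derivative ?p (at r)) (at r)"
    by (simp add: vector_derivative_works)
  moreover have "vector_derivative ?p (at r) = potential n k m r * f r"
    using assms(2)[OF r] r0 by (simp add: Lop_eq)
  ultimately show "(?p has_vector_derivative potential n k m r * f r) (at r)" by simp
qed

lemma flux_system_vector_derivative:
  assumes "flux_system n k m T f p" "r \<in> T"
  shows "vector_derivative f (at r) = p r / of_real r"
  using assms by (auto simp: flux_system_def intro!: vector_derivative_at)

text \<open>\<open>Lop\<close> differentiates the function s \<mapsto>
  \<open>vector_derivative f (at s)\<close>, which is known only on \<open>T\<close>. Openness of
  \<open>T\<close> allows it to be replaced near \<open>r\<close> by \<open>p s / s\<close>.\<close>

lemma flux_system_imp_Lop:
  assumes T: "open T" "T \<subseteq> {0<..}" and fs: "flux_system n k m T f p" and r: "r \<in> T"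
  shows "f differentiable at r \<and> (\<lambda>s. vector_derivative f (at s)) differentiable at r \<and>
    Lop n k m f r = 0"
proof (intro conjI)
  have r0: "0 < r" using T r by auto
  have vd: "vector_derivative f (at s) = p s / of_real s" if "s \<in> T" for s
    using flux_system_vector_derivative[OF fs that] .
  show "f differentiable at r"
    using fs r by (auto simp: flux_system_def intro: differentiableI_vector)
  have pd: "(p has_vector_derivative potential n k m r * f r) (at r)"
    using fs r by (auto simp: flux_system_def)
  have "(\<lambda>s. p s / of_real s) differentiable at r"
    using differentiableI_vector[OF pd] r0 by (intro differentiable_divide) auto
  thus "(\<lambda>s. vector_derivative f (at s)) differentiable at r"
    unfolding differentiable_def
    using has_derivative_transform_within_open[OF _ T(1) r] vd by (metis (no_types, lifting))
  have "((\<lambda>s. of_real s * vector_derivative f (at s)) has_vector_derivative potential n k m r * f r) (at r)"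
    by (rule has_vector_derivative_transform_within_open[OF pd T(1) r])
       (use vd T in force)
  hence "vector_derivative (\<lambda>s. of_real s * vector_derivative f (at s)) (at r) = potential n k m r * f r"
    by (rule vector_derivative_at)
  thus "Lop n k m f r = 0"
    using r0 by (simp add: Lop_eq)
qed

section \<open>Energy monotonicity and unique continuation\<close>

lemma antitone_limits_le:
  fixes W :: "real \<Rightarrow> real"
  assumes cd: "c < d"
    and mono: "\<And>x y. c < x \<Longrightarrow> x \<le> y \<Longrightarrow> y < d \<Longrightarrow> W y \<le> W x"
    and l: "(W \<longlongrightarrow> l) (at_right c)" and l': "(W \<longlongrightarrow> l') (at_left d)"
  shows "l' \<le> l"
proof -
  define x where "x = (c + d) / 2"
  have x: "c < x" "x < d" using cd by (auto simp: x_def)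
  have "W x \<le> l"
    by (rule tendsto_lowerbound[OF l])
       (use x mono in \<open>auto simp: eventually_at_right_field intro!: exI[of _ x]\<close>)
  moreover have "l' \<le> W x"
    by (rule tendsto_upperbound[OF l'])
       (use x mono in \<open>auto simp: eventually_at_left_field intro!: exI[of _ x]\<close>)
  ultimately show ?thesis by simp
qed

lemma has_real_derivative_Re:
  "(f has_vector_derivative D) (at x) \<Longrightarrow> ((\<lambda>x. Re (f x)) has_real_derivative Re D) (at x)"
  unfolding has_real_derivative_iff_has_vector_derivative
  by (rule bounded_linear.has_vector_derivative[OF bounded_linear_Re])

text \<open>The derivative has real part \<bar>p\<bar>^2 / r Re \<gamma> + \<bar>f\<bar>^2 (m^2 / r
  Re \<gamma> - n^2 r Re (\<gamma> k^2)), and each term is nonpositive by the sign conditions on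
  \<gamma>.\<close>

lemma energy_antitone:
  assumes fs: "flux_system n k m {c<..<d} f p" and c: "0 \<le> c"
    and \<gamma>: "Re \<gamma> \<le> 0" "0 \<le> Re (\<gamma> * k\<^sup>2)"
    and xy: "c < x" "x \<le> y" "y < d"
  shows "Re (\<gamma> * p y * cnj (f y)) \<le> Re (\<gamma> * p x * cnj (f x))"
proof (rule DERIV_nonpos_imp_nonincreasing[OF xy(2)])
  fix r assume "x \<le> r" "r \<le> y"
  hence r: "r \<in> {c<..<d}" "0 < r" using xy c by auto
  have f': "(f has_vector_derivative p r / of_real r) (at r)"
    and p': "(p has_vector_derivative potential n k m r * f r) (at r)"
    using fs r by (auto simp: flux_system_def)
  have "((\<lambda>r. \<gamma> * p r * cnj (f r)) has_vector_derivative
      \<gamma> * p r * cnj (p r / of_real r) + \<gamma> * (potential n k m r * f r) * cnj (f r)) (at r)"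
    by (intro has_vector_derivative_mult has_vector_derivative_cnj has_vector_derivative_mult_right f' p')
  note has_real_derivative_Re[OF this]
  moreover have "Re (\<gamma> * p r * cnj (p r / of_real r) + \<gamma> * (potential n k m r * f r) * cnj (f r)) \<le> 0"
  proof -
    have "\<gamma> * p r * cnj (p r / of_real r) = of_real ((cmod (p r))\<^sup>2 / r) * \<gamma>"
      using complex_norm_square[of "p r"] by (simp add: field_simps)
    moreover have "\<gamma> * (potential n k m r * f r) * cnj (f r) = of_real ((cmod (f r))\<^sup>2) * (\<gamma> * potential n k m r)"
      using complex_norm_square[of "f r"] by (simp add: field_simps)
    moreover have "\<gamma> * potential n k m r = of_real ((of_int m)\<^sup>2 / r) * \<gamma> - of_real ((n r)\<^sup>2 * r) * (\<gamma> * k\<^sup>2)"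
      by (simp add: potential_def field_simps power2_eq_square)
    \<comment> \<open>The product rule for \<open>Re\<close> is instantiated at real left factors
      only, which keeps \<open>Re (\<gamma> * k\<^sup>2)\<close> in one piece so that its sign can
      be used.\<close>
    ultimately have "Re (\<gamma> * p r * cnj (p r / of_real r) + \<gamma> * (potential n k m r * f r) * cnj (f r)) =
      (cmod (p r))\<^sup>2 / r * Re \<gamma> + (cmod (f r))\<^sup>2 * ((of_int m)\<^sup>2 / r * Re \<gamma> - (n r)\<^sup>2 * r * Re (\<gamma> * k\<^sup>2))"
      by (simp only: Re_complex_of_real Im_complex_of_real plus_complex.sel minus_complex.sel times_complex.sel(1)[of "of_real _"] mult_zero_left diff_zero)
    also have "\<dots> \<le> 0"
    proof -
      have "(cmod (p r))\<^sup>2 / r * Re \<gamma> \<le> 0" "(of_int m)\<^sup>2 / r * Re \<gamma> \<le> 0"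
        using r \<gamma> by (intro mult_nonneg_nonpos; simp)+
      moreover have "0 \<le> (n r)\<^sup>2 * r * Re (\<gamma> * k\<^sup>2)"
        using r \<gamma> by (intro mult_nonneg_nonneg) auto
      ultimately have "(cmod (p r))\<^sup>2 / r * Re \<gamma> \<le> 0" "(of_int m)\<^sup>2 / r * Re \<gamma> - (n r)\<^sup>2 * r * Re (\<gamma> * k\<^sup>2) \<le> 0"
        by auto
      from add_nonpos_nonpos[OF this(1) mult_nonneg_nonpos[OF zero_le_power2 this(2)]] show ?thesis .
    qed
    finally show ?thesis .
  qed
  ultimately show "\<exists>D. DERIV (\<lambda>r. Re (\<gamma> * p r * cnj (f r))) r :> D \<and> D \<le> 0" by blast
qed

lemma potential_bound:
  assumes "0 < r" "r \<le> d" "\<bar>n r\<bar> \<le> N"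
  shows "cmod (potential n k m r) \<le> ((of_int m)\<^sup>2 + (cmod k)\<^sup>2 * N\<^sup>2 * d\<^sup>2) / r"
proof -
  have "cmod (potential n k m r) \<le> cmod ((of_int m)\<^sup>2 / of_real r) + cmod ((k * of_real (n r))\<^sup>2 * of_real r)"
    unfolding potential_def by (rule norm_triangle_ineq4)
  also have "\<dots> = ((of_int m)\<^sup>2 + (cmod k)\<^sup>2 * \<bar>n r\<bar>\<^sup>2 * r\<^sup>2) / r"
    using assms by (simp add: norm_mult norm_divide norm_power power_mult_distrib field_simps power2_eq_square)
  also have "\<dots> \<le> ((of_int m)\<^sup>2 + (cmod k)\<^sup>2 * N\<^sup>2 * d\<^sup>2) / r"
    using assms by (intro divide_right_mono add_left_mono mult_mono power_mono) auto
  finally show ?thesis .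
qed

text \<open>Between \<open>r0\<close> > 0 and \<open>d\<close> the first order system has bounded
  coefficients, so a solution whose Cauchy data vanish at \<open>d\<close> vanishes at
  \<open>r0\<close>. Zero data are given as limits, hence the comparison of \<open>E r0\<close> with
  the limit of \<open>E\<close>.\<close>

lemma zero_cauchy_data:
  assumes fs: "flux_system n k m {c<..<d} f p" and c: "0 \<le> c"
    and n: "\<And>r. r \<in> {c<..<d} \<Longrightarrow> \<bar>n r\<bar> \<le> N"
    and f0: "(f \<longlongrightarrow> 0) (at_left d)" and p0: "(p \<longlongrightarrow> 0) (at_left d)"
    and r0: "r0 \<in> {c<..<d}"
  shows "f r0 = 0"
proof -
  \<comment> \<open>The two summands bound the coefficients 1 / r and \<open>potential\<close> for r
    \<ge> \<open>r0\<close>. With A = \<bar>f\<bar> and B = \<bar>p\<bar> the derivative of A^2 +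
    B^2 is at most 2 A B K \<le> (A^2 + B^2) K in modulus.\<close>
  define K where "K = 1 / r0 + ((of_int m)\<^sup>2 + (cmod k)\<^sup>2 * N\<^sup>2 * d\<^sup>2) / r0"
  define E where "E = (\<lambda>r. exp (K * r) * (Re (f r * cnj (f r)) + Re (p r * cnj (p r))))"
  have r00: "0 < r0" using c r0 by auto
  \<comment> \<open>\<open>exp (K * r)\<close> compensates the possible decay of \<open>\<bar>f\<bar>\<^sup>2 + \<bar>p\<bar>\<^sup>2\<close> (Gronwall).\<close>
  have "E r0 \<le> E x" if x: "r0 < x" "x < d" for x
  proof (rule DERIV_nonneg_imp_nondecreasing[where f = E])
    show "r0 \<le> x" using x by simp
    fix r assume rr: "r0 \<le> r" "r \<le> x"
    hence r: "r \<in> {c<..<d}" "0 < r" using x c r0 by auto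
    have f': "(f has_vector_derivative p r / of_real r) (at r)"
      and p': "(p has_vector_derivative potential n k m r * f r) (at r)"
      using fs r by (auto simp: flux_system_def)
    define D where "D = Re (f r * cnj (p r / of_real r) + p r / of_real r * cnj (f r))
      + Re (p r * cnj (potential n k m r * f r) + potential n k m r * f r * cnj (p r))"
    have "((\<lambda>r. Re (f r * cnj (f r)) + Re (p r * cnj (p r))) has_real_derivative D) (at r)"
      unfolding D_def
      by (intro DERIV_add has_real_derivative_Re has_vector_derivative_mult has_vector_derivative_cnj f' p')
    moreover have "((\<lambda>r. exp (K * r)) has_real_derivative exp (K * r) * K) (at r)"
      by (auto intro!: derivative_eq_intros)
    ultimately have "(E has_real_derivative exp (K * r) * K * (Re (f r * cnj (f r)) + Re (p r * cnj (p r))) + D * exp (K * r)) (at r)"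
      unfolding E_def by (rule DERIV_mult[rotated])
    moreover have "0 \<le> exp (K * r) * K * (Re (f r * cnj (f r)) + Re (p r * cnj (p r))) + D * exp (K * r)"
    proof -
      have q: "cmod (potential n k m r) \<le> ((of_int m)\<^sup>2 + (cmod k)\<^sup>2 * N\<^sup>2 * d\<^sup>2) / r0"
        by (rule order_trans[OF potential_bound[of r d n N]])
           (use r n rr r00 in \<open>auto intro!: divide_left_mono add_nonneg_nonneg\<close>)
      define A where "A = cmod (f r)"
      define B where "B = cmod (p r)"
      have "\<bar>Re (f r * cnj (p r / of_real r) + p r / of_real r * cnj (f r))\<bar> \<le>
          cmod (f r * cnj (p r / of_real r)) + cmod (p r / of_real r * cnj (f r))"
        using abs_Re_le_cmod norm_triangle_ineq order_trans by blast
      also have "\<dots> = 2 * A * B * (1 / r)" using r by (simp add: A_def B_def norm_mult norm_divide)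
      also have "\<dots> \<le> 2 * A * B * (1 / r0)"
        using rr r00 by (intro mult_left_mono divide_left_mono) (auto simp: A_def B_def)
      finally have 1: "\<bar>Re (f r * cnj (p r / of_real r) + p r / of_real r * cnj (f r))\<bar> \<le> 2 * A * B * (1 / r0)" .
      have "\<bar>Re (p r * cnj (potential n k m r * f r) + potential n k m r * f r * cnj (p r))\<bar> \<le>
          cmod (p r * cnj (potential n k m r * f r)) + cmod (potential n k m r * f r * cnj (p r))"
        using abs_Re_le_cmod norm_triangle_ineq order_trans by blast
      also have "\<dots> = 2 * A * B * cmod (potential n k m r)" by (simp add: A_def B_def norm_mult)
      also have "\<dots> \<le> 2 * A * B * (((of_int m)\<^sup>2 + (cmod k)\<^sup>2 * N\<^sup>2 * d\<^sup>2) / r0)"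
        by (intro mult_left_mono q) (auto simp: A_def B_def)
      finally have "\<bar>D\<bar> \<le> 2 * A * B * K" using 1 unfolding D_def K_def by (simp add: distrib_left)
      also have "\<dots> \<le> (A\<^sup>2 + B\<^sup>2) * K"
        using r00 sum_squares_bound[of A B] by (intro mult_right_mono) (auto simp: K_def)
      also have "\<dots> = K * (Re (f r * cnj (f r)) + Re (p r * cnj (p r)))"
        by (simp add: A_def B_def cmod_def power2_eq_square)
      finally have "0 \<le> exp (K * r) * (K * (Re (f r * cnj (f r)) + Re (p r * cnj (p r))) + D)"
        by (intro mult_nonneg_nonneg) auto
      thus ?thesis by (simp add: algebra_simps)
    qed
    ultimately show "\<exists>y. DERIV E r :> y \<and> 0 \<le> y" by blast
  qed
  moreover have "(E \<longlongrightarrow> exp (K * d) * (Re (0 * cnj 0) + Re (0 * cnj 0))) (at_left d)"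
    unfolding E_def by (intro tendsto_intros f0 p0)
  ultimately have "E r0 \<le> exp (K * d) * (Re (0 * cnj 0) + Re (0 * cnj 0))"
    using r0 by (intro tendsto_lowerbound) (auto simp: eventually_at_left_field intro!: exI[of _ r0])
  hence "Re (f r0 * cnj (f r0)) + Re (p r0 * cnj (p r0)) \<le> 0"
    by (simp add: E_def mult_le_0_iff)
  thus ?thesis
    by (auto simp: complex_eq_iff add_nonneg_eq_0_iff sum_power2_eq_zero_iff simp flip: power2_eq_square
      intro: antisym) (smt (verit) sum_power2_eq_zero_iff zero_le_power2)+
qed

text \<open>A derivative that tends to 0 is bounded near 0, so \<open>f\<close> is bounded there by
  the mean value inequality. The factor r then forces the product to 0.\<close>

lemma flux_tendsto_0_even:
  fixes f :: "real \<Rightarrow> complex"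
  assumes d: "0 < d" and der: "\<And>r. r \<in> {0<..<d} \<Longrightarrow> f differentiable at r"
    and lim: "((\<lambda>r. vector_derivative f (at r)) \<longlongrightarrow> 0) (at_right 0)"
  shows "((\<lambda>r. of_real r * vector_derivative f (at r) * cnj (f r)) \<longlongrightarrow> 0) (at_right 0)"
proof -
  have "\<forall>\<^sub>F r in at_right 0. norm (vector_derivative f (at r)) < 1"
    using tendstoD[OF lim, of 1] by (simp add: dist_norm)
  then obtain e where e: "0 < e" "\<And>r. 0 < r \<Longrightarrow> r < e \<Longrightarrow> norm (vector_derivative f (at r)) < 1"
    by (auto simp: eventually_at_right_field)
  define x where "x = min e d / 2"
  have x: "0 < x" "x < e" "x < d" using e d by (auto simp: x_def)
  have fb: "norm (f r) \<le> norm (f x) + x" if r: "0 < r" "r \<le> x" for r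
  proof -
    have "norm (f r - f x) \<le> 1 * norm (r - x)"
    proof (rule differentiable_bound[where S = "{r..x}" and f' = "\<lambda>s h. h *\<^sub>R vector_derivative f (at s)"])
      fix s assume s: "s \<in> {r..x}"
      have "(f has_vector_derivative vector_derivative f (at s)) (at s)"
        using der[of s] s r x by (simp add: vector_derivative_works)
      thus "(f has_derivative (\<lambda>h. h *\<^sub>R vector_derivative f (at s))) (at s within {r..x})"
        by (simp add: has_vector_derivative_def has_derivative_at_withinI)
      show "onorm (\<lambda>h. h *\<^sub>R vector_derivative f (at s)) \<le> 1"
      proof (rule onorm_bound)
        show "norm (h *\<^sub>R vector_derivative f (at s)) \<le> 1 * norm h" for h
          using mult_left_mono[OF less_imp_le[OF e(2)[of s]], of "norm h"] s r x by simp
      qed simp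
    qed (use r in auto)
    thus ?thesis using r norm_triangle_ineq2[of "f r" "f x"] by simp
  qed
  show ?thesis
  proof (rule Lim_null_comparison)
    show "\<forall>\<^sub>F r in at_right 0. norm (of_real r * vector_derivative f (at r) * cnj (f r)) \<le> r * 1 * (norm (f x) + x)"
      unfolding eventually_at_right_field
    proof (intro exI[of _ x] conjI allI impI)
      fix r assume r: "0 < r" "r < x"
      show "norm (of_real r * vector_derivative f (at r) * cnj (f r)) \<le> r * 1 * (norm (f x) + x)"
        unfolding norm_mult using r fb[of r] e(2)[of r] x by (intro mult_mono) auto
    qed (use x in auto)
    have "((\<lambda>r. r * 1 * (norm (f x) + x)) \<longlongrightarrow> 0 * 1 * (norm (f x) + x)) (at_right 0)"
      by (intro tendsto_intros)
    thus "((\<lambda>r. r * 1 * (norm (f x) + x)) \<longlongrightarrow> 0) (at_right 0)" by simp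
  qed
qed

text \<open>In the variable \<open>t = ln r\<close> the flux is \<open>df/dt\<close>, and \<open>d\<^sup>2f/dt\<^sup>2\<close> is a bounded multiple of \<open>f\<close>.
  So \<open>f \<longlongrightarrow> 0\<close> forces \<open>df/dt \<longlongrightarrow> 0\<close>, by comparing \<open>f\<close> with its tangent on an interval of length \<open>ln 2\<close>.\<close>

lemma flux_tendsto_0_odd:
  assumes d: "0 < d" and fs: "flux_system n k m {0<..<d} f p"
    and n: "\<And>r. r \<in> {0<..<d} \<Longrightarrow> \<bar>n r\<bar> \<le> N"
    and lim: "(f \<longlongrightarrow> 0) (at_right 0)"
  shows "(p \<longlongrightarrow> 0) (at_right 0)"
proof (rule tendstoI)
  fix e :: real assume e: "0 < e"
  define C where "C = (of_int m)\<^sup>2 + (cmod k)\<^sup>2 * N\<^sup>2 * d\<^sup>2"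
  have C0: "0 \<le> C" by (simp add: C_def)
  \<comment> \<open>The comparison below yields ln 2 \<bar>p r\<bar> \<le> (C + 2) \<epsilon>: C
    \<epsilon> from the deviation from the tangent and 2 \<epsilon> from the two values of
    \<open>f\<close>. The further \<epsilon> makes the inequality strict.\<close>
  define \<epsilon> where "\<epsilon> = e * ln 2 / (C + 3)"
  have \<epsilon>: "0 < \<epsilon>" using e C0 by (simp add: \<epsilon>_def)
  have "\<forall>\<^sub>F r in at_right 0. norm (f r) < \<epsilon>"
    using tendstoD[OF lim \<epsilon>] by (simp add: dist_norm)
  then obtain \<delta> where \<delta>: "0 < \<delta>" "\<And>r. 0 < r \<Longrightarrow> r < \<delta> \<Longrightarrow> norm (f r) < \<epsilon>"
    by (auto simp: eventually_at_right_field)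
  define x where "x = min \<delta> d / 2"
  have x: "0 < x" "2 * x \<le> \<delta>" "2 * x \<le> d" using \<delta> d by (auto simp: x_def)
  have main: "norm (p r) < e" if r: "0 < r" "r < x" for r
  proof -
    have dom: "s \<in> {0<..<d}" "0 < s" "s < \<delta>" if "s \<in> {r..2*r}" for s using that r x by auto
    have f': "(f has_vector_derivative p s / of_real s) (at s within {r..2*r})"
      and p': "(p has_vector_derivative potential n k m s * f s) (at s within {r..2*r})" if "s \<in> {r..2*r}" for s
      using fs dom[OF that] by (auto simp: flux_system_def intro: has_vector_derivative_at_within)
    \<comment> \<open>The derivative of \<open>p\<close> is at most C \<epsilon> / r on an interval
      of length r, so the flux changes by at most C \<epsilon>, uniformly in r.\<close>
    have ps: "norm (p s - p r) \<le> C * \<epsilon>" if s: "s \<in> {r..2*r}" for s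
    proof -
      have "norm (p s - p r) \<le> C * \<epsilon> / r * norm (s - r)"
      proof (rule differentiable_bound[where S = "{r..2*r}"])
        fix t assume t: "t \<in> {r..2*r}"
        show "(p has_derivative (\<lambda>h. h *\<^sub>R (potential n k m t * f t))) (at t within {r..2*r})"
          using p'[OF t] by (simp add: has_vector_derivative_def)
        have "norm (potential n k m t * f t) \<le> C / t * \<epsilon>"
          unfolding norm_mult C_def
          using dom[OF t] n \<delta>(2)[of t] by (intro mult_mono potential_bound) (auto intro!: divide_nonneg_pos add_nonneg_nonneg)
        also have "\<dots> \<le> C / r * \<epsilon>"
          using t r C0 \<epsilon> by (intro mult_right_mono divide_left_mono) auto
        finally have "norm (potential n k m t * f t) \<le> C * \<epsilon> / r" by simp
        from mult_left_mono[OF this]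
        show "onorm (\<lambda>h. h *\<^sub>R (potential n k m t * f t)) \<le> C * \<epsilon> / r"
          by (intro onorm_bound) (use r C0 \<epsilon> in \<open>auto simp: mult.commute\<close>)
      qed (use s r in auto)
      also have "\<dots> \<le> C * \<epsilon> / r * r" using s r C0 \<epsilon> by (intro mult_left_mono) auto
      finally show ?thesis using r by simp
    qed
    \<comment> \<open>Subtracting \<open>ln s\<close> times \<open>p r\<close> removes the tangent
      in the logarithmic variable; the derivative that is left is (p s - p r) / s.\<close>
    have "norm ((f (2*r) - of_real (ln (2*r)) * p r) - (f r - of_real (ln r) * p r)) \<le> C * \<epsilon> / r * norm (2*r - r)"
    proof (rule differentiable_bound[where S = "{r..2*r}" and f = "\<lambda>s. f s - of_real (ln s) * p r"])
      fix s assume s: "s \<in> {r..2*r}"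
      have "((\<lambda>s. complex_of_real (ln s)) has_vector_derivative of_real (1 / s)) (at s within {r..2*r})"
        by (rule has_vector_derivative_of_real)
           (use s r in \<open>auto intro!: derivative_eq_intros simp flip: has_real_derivative_iff_has_vector_derivative\<close>)
      from has_vector_derivative_diff[OF f'[OF s] has_vector_derivative_mult_left[OF this, of "p r"]]
      have "((\<lambda>s. f s - of_real (ln s) * p r) has_vector_derivative p s / of_real s - of_real (1 / s) * p r) (at s within {r..2*r})" .
      moreover have "p s / of_real s - of_real (1 / s) * p r = (p s - p r) / of_real s"
        by (simp add: diff_divide_distrib)
      ultimately show "((\<lambda>s. f s - of_real (ln s) * p r) has_derivative (\<lambda>h. h *\<^sub>R ((p s - p r) / of_real s))) (at s within {r..2*r})"
        by (simp add: has_vector_derivative_def)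
      have "norm ((p s - p r) / of_real s) \<le> C * \<epsilon> / s"
        using dom[OF s] ps[OF s] by (simp add: norm_divide divide_right_mono)
      also have "\<dots> \<le> C * \<epsilon> / r"
        using s r C0 \<epsilon> by (intro divide_left_mono) auto
      finally have "norm ((p s - p r) / of_real s) \<le> C * \<epsilon> / r" .
      from mult_left_mono[OF this]
      show "onorm (\<lambda>h. h *\<^sub>R ((p s - p r) / of_real s)) \<le> C * \<epsilon> / r"
        by (intro onorm_bound) (use r C0 \<epsilon> in \<open>auto simp: mult.commute simp del: norm_divide\<close>)
    qed (use r in auto)
    moreover have "(f (2*r) - of_real (ln (2*r)) * p r) - (f r - of_real (ln r) * p r) = (f (2*r) - f r) - of_real (ln 2) * p r"
      using r by (simp add: ln_mult algebra_simps)
    ultimately have "norm ((f (2*r) - f r) - of_real (ln 2) * p r) \<le> C * \<epsilon>" using r by simp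
    moreover have "norm (of_real (ln 2) * p r) \<le> norm (f (2*r) - f r) + norm ((f (2*r) - f r) - of_real (ln 2) * p r)"
      using norm_triangle_ineq4[of "f (2*r) - f r" "(f (2*r) - f r) - of_real (ln 2) * p r"] by simp
    moreover have "norm (f (2*r) - f r) \<le> \<epsilon> + \<epsilon>"
      using norm_triangle_ineq4[of "f (2*r)" "f r"] \<delta>(2)[of r] \<delta>(2)[of "2*r"] r x by simp
    ultimately have "norm (complex_of_real (ln 2) * p r) \<le> (C + 2) * \<epsilon>" by (simp add: algebra_simps)
    also have "norm (complex_of_real (ln 2) * p r) = ln 2 * norm (p r)" by (simp add: norm_mult)
    finally have "ln 2 * norm (p r) < (C + 3) * \<epsilon>" using \<epsilon> by (simp add: algebra_simps)
    also have "\<dots> = ln 2 * e" using C0 by (simp add: \<epsilon>_def)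
    finally show ?thesis by (simp add: mult_less_cancel_left_pos)
  qed
  show "\<forall>\<^sub>F r in at_right 0. dist (p r) 0 < e"
    using main x(1) by (auto simp: eventually_at_right_field dist_norm)
qed

text \<open>The left end enters only through the limit of the product \<open>p * cnj f\<close>. This
  covers the origin, where the separate limits need not be at hand, as well as an inner circle. At
  the right end the boundary condition turns a = 0 into zero flux too.\<close>

lemma homogeneous_zero:
  assumes fs: "flux_system n k m {c<..<d} f p" and cd: "0 \<le> c" "c < d"
    and n: "\<And>r. r \<in> {c<..<d} \<Longrightarrow> \<bar>n r\<bar> \<le> N"
    and \<gamma>: "Re \<gamma> \<le> 0" "0 \<le> Re (\<gamma> * k\<^sup>2)" "0 < Re (\<gamma> * \<beta>)"
    and l: "((\<lambda>r. p r * cnj (f r)) \<longlongrightarrow> l) (at_right c)" "Re (\<gamma> * l) \<le> 0"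
    and a: "(f \<longlongrightarrow> a) (at_left d)" and b: "(p \<longlongrightarrow> of_real d * (\<beta> * a)) (at_left d)"
    and r: "r \<in> {c<..<d}"
  shows "f r = 0"
proof -
  have "Re (\<gamma> * (of_real d * (\<beta> * a)) * cnj a) \<le> Re (\<gamma> * l)"
  proof (rule antitone_limits_le[OF cd(2)])
    show "((\<lambda>r. Re (\<gamma> * p r * cnj (f r))) \<longlongrightarrow> Re (\<gamma> * (of_real d * (\<beta> * a)) * cnj a)) (at_left d)"
      by (intro tendsto_intros a b)
    have "((\<lambda>r. Re (\<gamma> * (p r * cnj (f r)))) \<longlongrightarrow> Re (\<gamma> * l)) (at_right c)"
      by (intro tendsto_intros l)
    thus "((\<lambda>r. Re (\<gamma> * p r * cnj (f r))) \<longlongrightarrow> Re (\<gamma> * l)) (at_right c)" by (simp add: mult.assoc)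
  qed (rule energy_antitone[OF fs cd(1) \<gamma>(1,2)])
  moreover have "\<gamma> * (of_real d * (\<beta> * a)) * cnj a = of_real (d * (cmod a)\<^sup>2) * (\<gamma> * \<beta>)"
    using complex_norm_square[of a] by (simp add: algebra_simps)
  ultimately have "d * (cmod a)\<^sup>2 * Re (\<gamma> * \<beta>) \<le> 0" using l(2) by (simp only: Re_complex_of_real Im_complex_of_real times_complex.sel(1)[of "of_real _"])
  moreover have "0 < d" using cd by simp
  ultimately have "a = 0" using \<gamma>(3) by (simp add: mult_le_0_iff del: times_complex.sel)
  with a b show ?thesis using zero_cauchy_data[OF fs cd(1) n _ _ r] by simp
qed

section \<open>Testing with single harmonics\<close>

text \<open>Boundary functions are functions on the plane here, so cis (m \<theta>) is written as
  the m-th power of z / \<bar>z\<bar>, which involves no choice of an argument.\<close>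

definition harmonic :: "int \<Rightarrow> complex \<Rightarrow> complex" where
  "harmonic m z = sgn z powi m"

lemma harmonic_cis: "0 < x \<Longrightarrow> harmonic m (of_real x * cis \<theta>) = cis (of_int m * \<theta>)"
  by (simp add: harmonic_def sgn_mult sgn_of_real cis_power_int)

lemma integral_cis_multiple:
  "(LINT \<theta>:{0..2*pi}|lebesgue. cis (of_int l * \<theta>)) = (if l = 0 then of_real (2 * pi) else 0)"
proof -
  have "(LINT \<theta>:{0..2*pi}|lebesgue. cis (of_int l * \<theta>)) = integral {0..2*pi} (\<lambda>\<theta>. cis (of_int l * \<theta>))"
    by (intro set_lebesgue_integral_eq_integral absolutely_integrable_continuous_real continuous_intros)
  also have "\<dots> = (if l = 0 then of_real (2 * pi) else 0)"
  proof (cases "l = 0")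
    case False
    define c where "c = \<i> * of_int l"
    have c: "c \<noteq> 0" using False by (simp add: c_def)
    have eq: "cis (of_int l * \<theta>) = exp (c * of_real \<theta>)" for \<theta>
      by (simp add: cis_conv_exp c_def mult_ac)
    have "((\<lambda>\<theta>. exp (c * of_real \<theta>)) has_integral
        (exp (c * of_real (2 * pi)) / c - exp (c * of_real 0) / c)) {0..2*pi}"
    proof (rule fundamental_theorem_of_calculus)
      fix \<theta> :: real
      have "((\<lambda>z. exp (c * z) / c) has_field_derivative exp (c * of_real \<theta>)) (at (of_real \<theta>))"
        using c by (auto intro!: derivative_eq_intros)
      thus "((\<lambda>\<theta>. exp (c * of_real \<theta>) / c) has_vector_derivative exp (c * of_real \<theta>)) (at \<theta> within {0..2*pi})"
        by (rule has_vector_derivative_real_field)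
    qed simp
    hence "integral {0..2*pi} (\<lambda>\<theta>. cis (of_int l * \<theta>)) = exp (c * of_real (2 * pi)) / c - 1 / c"
      unfolding eq by (auto simp: integral_unique)
    moreover have "exp (c * of_real (2 * pi)) = 1"
      using cis_multiple_2pi[of "of_int l"] eq[of "2 * pi"] by (simp add: mult_ac)
    ultimately show ?thesis using False by simp
  qed (simp add: scaleR_conv_of_real)
  finally show ?thesis .
qed

lemma circle_coeff_harmonic:
  assumes "0 < x"
  shows "circle_coeff x (harmonic m) = (\<lambda>j. if j = m then 1 else 0)"
proof
  fix j
  have "cis (of_int m * \<theta>) * cis (- (of_int j * \<theta>)) = cis (of_int (m - j) * \<theta>)" for \<theta>
    by (simp add: cis_mult algebra_simps)
  thus "circle_coeff x (harmonic m) j = (if j = m then 1 else 0)"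
    using assms by (simp add: circle_coeff_def harmonic_cis integral_cis_multiple del: of_int_diff)
qed

lemma harmonic_in_H_half:
  assumes "0 < x"
  shows "harmonic m \<in> H_half x"
proof -
  have "L2_on {0..2*pi} (\<lambda>\<theta>. harmonic m (of_real x * cis \<theta>))"
  proof -
    have "set_integrable lebesgue {0..2*pi} (\<lambda>\<theta>. cis (of_int m * \<theta>))"
      by (intro absolutely_integrable_continuous_real continuous_intros)
    hence "set_borel_measurable lebesgue {0..2*pi} (\<lambda>\<theta>. cis (of_int m * \<theta>))"
      unfolding set_integrable_def set_borel_measurable_def by (rule borel_measurable_integrable)
    moreover have "set_integrable lebesgue {0..2*pi} (\<lambda>\<theta>. (cmod (cis (of_int m * \<theta>)))\<^sup>2)"
      by (intro absolutely_integrable_continuous_real continuous_intros)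
    ultimately show ?thesis using assms by (simp add: L2_on_def harmonic_cis)
  qed
  moreover have "circle_coeff x (harmonic m) \<in> Hs_coeffs (1/2)"
    unfolding Hs_coeffs_def circle_coeff_harmonic[OF assms] mem_Collect_eq
    by (rule finite_nonzero_values_imp_summable_on) (rule finite_subset[of _ "{m}"], auto)
  ultimately show ?thesis by (simp add: H_half_def)
qed

lemma harmonic_not_null:
  assumes "0 < x"
  shows "\<not> circle_null x (harmonic m)"
proof
  assume "circle_null x (harmonic m)"
  hence "AE \<theta> in lebesgue. \<theta> \<notin> {0..2*pi}"
    using assms unfolding circle_null_def by (simp add: harmonic_cis)
  hence "{0..2*pi} \<in> null_sets lebesgue"
    by (subst AE_iff_null_sets) auto
  thus False by (simp add: null_sets_def)
qed

lemma circle_norm_harmonic: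
  assumes "0 < x"
  shows "(circle_norm x (harmonic m))\<^sup>2 = 2 * pi * x"
proof -
  have "(LINT \<theta>:{0..2*pi}|lebesgue. (1::real)) = 2 * pi"
    by (simp add: set_lebesgue_integral_def)
  thus ?thesis using assms by (simp add: circle_norm_def harmonic_cis)
qed

text \<open>The m-th harmonic has a single Fourier coefficient, so the series collapses to the m-th
  multiplier. The factor is its squared L^2 norm, which cancels in the lower bound of the sign
  hypothesis.\<close>

lemma circle_pairing_harmonic:
  assumes "0 < x"
  shows "circle_pairing x (mult_op b x (harmonic m)) (harmonic m) = of_real (2 * pi * x) * b m"
proof -
  have "(\<Sum>\<^sub>\<infinity>j. b j * (if j = m then 1 else 0) * cnj (if j = m then 1 else 0)) = (\<Sum>\<^sub>\<infinity>j\<in>{m}. b j)"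
    by (rule infsum_cong_neutral) auto
  thus ?thesis
    by (simp add: circle_pairing_def mult_op_def circle_coeff_harmonic[OF assms])
qed

section \<open>Existence for the radial equation\<close>

lemma flux_system_combine:
  assumes "flux_system n k m T f p" "flux_system n k m T g q"
  shows "flux_system n k m T (\<lambda>r. a * f r + b * g r) (\<lambda>r. a * p r + b * q r)"
  unfolding flux_system_def
proof (intro ballI conjI)
  fix r assume r: "r \<in> T"
  have 1: "(f has_vector_derivative p r / of_real r) (at r)" "(g has_vector_derivative q r / of_real r) (at r)"
    "(p has_vector_derivative potential n k m r * f r) (at r)" "(q has_vector_derivative potential n k m r * g r) (at r)"
    using assms r by (auto simp: flux_system_def)
  have "((\<lambda>r. a * f r + b * g r) has_vector_derivative a * (p r / of_real r) + b * (q r / of_real r)) (at r)"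
    by (intro has_vector_derivative_add has_vector_derivative_mult_right 1)
  thus "((\<lambda>r. a * f r + b * g r) has_vector_derivative (a * p r + b * q r) / of_real r) (at r)"
    by (simp add: add_divide_distrib)
  have "((\<lambda>r. a * p r + b * q r) has_vector_derivative a * (potential n k m r * f r) + b * (potential n k m r * g r)) (at r)"
    by (intro has_vector_derivative_add has_vector_derivative_mult_right 1)
  thus "((\<lambda>r. a * p r + b * q r) has_vector_derivative potential n k m r * (a * f r + b * g r)) (at r)"
    by (simp add: algebra_simps)
qed

lemma eventually_Ioo_ends:
  fixes c d :: real
  assumes "c < d"
  shows "\<forall>\<^sub>F r in at_left d. r \<in> {c<..<d}" "\<forall>\<^sub>F r in at_right c. r \<in> {c<..<d}"
  using assms eventually_at_left_real eventually_at_right_real by blast+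

text \<open>On \<open>T\<close> the derivative is p / r, and r tends to a nonzero x. Solutions are
  constructed with continuous flux, whereas the boundary conditions speak of derivatives; this is
  the translation.\<close>

lemma end_values_iff_flux:
  assumes fs: "flux_system n k m T f p" and T: "\<forall>\<^sub>F r in F. r \<in> T" and x: "x \<noteq> 0"
    and F: "((\<lambda>r. r) \<longlongrightarrow> x) F"
  shows "end_values F f a b \<longleftrightarrow> (f \<longlongrightarrow> a) F \<and> (p \<longlongrightarrow> of_real x * b) F"
proof -
  have "((\<lambda>r. vector_derivative f (at r)) \<longlongrightarrow> b) F \<longleftrightarrow> ((\<lambda>r. p r / of_real r) \<longlongrightarrow> b) F"
    by (intro tendsto_cong eventually_mono[OF T]) (simp add: flux_system_vector_derivative[OF fs])
  also have "\<dots> \<longleftrightarrow> (p \<longlongrightarrow> of_real x * b) F"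
  proof
    assume "((\<lambda>r. p r / of_real r) \<longlongrightarrow> b) F"
    hence "((\<lambda>r. of_real r * (p r / of_real r)) \<longlongrightarrow> of_real x * b) F"
      by (intro tendsto_intros F)
    moreover have "\<forall>\<^sub>F r in F. of_real r * (p r / of_real r) = p r"
      using tendsto_imp_eventually_ne[OF F x] by eventually_elim auto
    ultimately show "(p \<longlongrightarrow> of_real x * b) F" by (simp cong: tendsto_cong)
  next
    assume "(p \<longlongrightarrow> of_real x * b) F"
    hence "((\<lambda>r. p r / of_real r) \<longlongrightarrow> of_real x * b / of_real x) F"
      by (intro tendsto_intros F) (use x in auto)
    thus "((\<lambda>r. p r / of_real r) \<longlongrightarrow> b) F" using x by simp
  qed
  finally show ?thesis by (simp add: end_values_def)
qed

text \<open>Records exactly the regularity that \<open>mode_in_H1\<close> asks for: the cofactor of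
  r^M is C^1 up to both end points. Unlike membership of a single mode in H^1, it passes to linear
  combinations by direct computation.\<close>

definition power_profile :: "real \<Rightarrow> real \<Rightarrow> nat \<Rightarrow> (real \<Rightarrow> complex) \<Rightarrow> bool" where
  "power_profile c d M f \<longleftrightarrow> (\<exists>g dg. continuous_on {c..d} g \<and> continuous_on {c..d} dg \<and>
     (\<forall>r\<in>{c<..<d}. (g has_vector_derivative dg r) (at r) \<and> f r = of_real r ^ M * g r))"

lemma power_profile_combine:
  assumes "power_profile c d M f" "power_profile c d M f'"
  shows "power_profile c d M (\<lambda>r. a * f r + b * f' r)"
proof -
  obtain g dg g' dg' where g: "continuous_on {c..d} g" "continuous_on {c..d} dg"
      "\<And>r. r \<in> {c<..<d} \<Longrightarrow> (g has_vector_derivative dg r) (at r)" "\<And>r. r \<in> {c<..<d} \<Longrightarrow> f r = of_real r ^ M * g r"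
    and g': "continuous_on {c..d} g'" "continuous_on {c..d} dg'"
      "\<And>r. r \<in> {c<..<d} \<Longrightarrow> (g' has_vector_derivative dg' r) (at r)" "\<And>r. r \<in> {c<..<d} \<Longrightarrow> f' r = of_real r ^ M * g' r"
    using assms unfolding power_profile_def by blast
  show ?thesis unfolding power_profile_def
  proof (intro exI conjI ballI)
    show "continuous_on {c..d} (\<lambda>r. a * g r + b * g' r)" "continuous_on {c..d} (\<lambda>r. a * dg r + b * dg' r)"
      by (intro continuous_intros g g')+
    fix r assume r: "r \<in> {c<..<d}"
    show "((\<lambda>r. a * g r + b * g' r) has_vector_derivative a * dg r + b * dg' r) (at r)"
      by (intro has_vector_derivative_add has_vector_derivative_mult_right g g' r)
    show "a * f r + b * f' r = of_real r ^ M * (a * g r + b * g' r)"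
      using g(4) g'(4) r by (simp add: algebra_simps)
  qed
qed

lemma radial_solutionI:
  assumes tau: "tau \<xi> j = {c<..<d}" and cd: "0 \<le> c" "c < d"
    and pf: "power_profile c d (nat \<bar>m\<bar>) f" and fs: "flux_system n k m {c<..<d} f p"
  shows "radial_solution \<xi> n j k m f"
proof -
  have "mode m f \<in> H1 (Omega \<xi> j)"
    using pf mode_in_H1[OF cd, of _ _ f m] unfolding power_profile_def Omega_def tau by blast
  moreover have "f differentiable at r \<and> (\<lambda>s. vector_derivative f (at s)) differentiable at r \<and> Lop n k m f r = 0"
    if "r \<in> {c<..<d}" for r
    using flux_system_imp_Lop[OF _ _ fs that] cd by fastforce
  ultimately show ?thesis unfolding radial_solution_def tau by blast
qed

lemma radial_solution_flux:
  assumes tau: "tau \<xi> j = {c<..<d}" and c: "0 \<le> c" and f: "radial_solution \<xi> n j k m f"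
  shows "flux_system n k m {c<..<d} f (\<lambda>r. of_real r * vector_derivative f (at r))"
  using f c unfolding radial_solution_def tau by (intro flux_systemI_Lop) auto

lemma has_vector_derivative_of_real_power:
  "((\<lambda>r. of_real r ^ M) has_vector_derivative (of_nat M * of_real r ^ (M - 1) :: complex)) (at r)"
  by (rule has_vector_derivative_real_field) (auto intro!: derivative_eq_intros)

text \<open>The second function is r f' for f = r^M g. At a singular left end this gives the regular
  solution with prescribed leading coefficient \<open>a\<close>; at a regular one, \<open>a\<close>
  and \<open>b\<close> parametrize all Cauchy data.\<close>

lemma flux_solution_exists:
  fixes c d :: real and m :: int
  defines "M \<equiv> nat \<bar>m\<bar>"
  assumes cd: "0 \<le> c" "c < d" and n: "C-lipschitz_on {c<..<d} n"
  obtains g dg where "continuous_on {c..d} g" "continuous_on {c..d} dg"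
    "g c = a" "dg c = (if c = 0 then 0 else b)"
    "power_profile c d M (\<lambda>r. of_real r ^ M * g r)"
    "flux_system n k m {c<..<d} (\<lambda>r. of_real r ^ M * g r)
       (\<lambda>r. of_nat M * of_real r ^ M * g r + of_real r ^ (M + 1) * dg r)"
proof -
  \<comment> \<open>The index is Lipschitz on the open interval only; its extension to the closure
    makes the coefficient \<open>Q\<close> continuous, hence bounded, on the closed
    interval.\<close>
  obtain n' where n': "C-lipschitz_on (closure {c<..<d}) n'" "\<And>x. x \<in> {c<..<d} \<Longrightarrow> n' x = n x"
    using lipschitz_extend_closure[OF n] by blast
  have cn: "continuous_on {c..d} n'"
    using lipschitz_on_continuous_on[OF n'(1)] cd by (simp add: closure_greaterThanLessThan)
  define Q where "Q = (\<lambda>r. - (k * of_real (n' r))\<^sup>2)"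
  have cQ: "continuous_on {c..d} Q" unfolding Q_def by (intro continuous_intros cn)
  obtain B where B: "\<And>r. r \<in> {c..d} \<Longrightarrow> norm (Q r) \<le> B"
    using compact_continuous_norm_bound[OF compact_Icc cQ] by blast
  interpret volterra c d B "2 * M + 1" Q
    by unfold_locales (use cd cQ B in auto)
  obtain g dg where g: "continuous_on {c..d} g" "continuous_on {c..d} dg"
    "\<And>r. r \<in> {c<..<d} \<Longrightarrow> (g has_vector_derivative dg r) (at r)"
    and P: "\<And>r. r \<in> {c<..<d} \<Longrightarrow>
      ((\<lambda>s. of_real (s ^ (2 * M + 1)) * dg s) has_vector_derivative of_real (r ^ (2 * M + 1)) * Q r * g r) (at r)"
    and ini: "g c = a" "dg c = (if c = 0 then 0 else b)"
    using ivp[of a b] by blast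
  have pf: "power_profile c d M (\<lambda>r. of_real r ^ M * g r)"
    unfolding power_profile_def using g by blast
  define p where "p = (\<lambda>r. of_nat M * of_real r ^ M * g r + of_real r ^ (M + 1) * dg r)"
  have "flux_system n k m {c<..<d} (\<lambda>r. of_real r ^ M * g r) p"
    unfolding flux_system_def
  proof (intro ballI conjI)
    fix r assume r: "r \<in> {c<..<d}"
    define R where "R = complex_of_real r"
    have r0: "0 < r" using r cd by auto
    hence R: "R \<noteq> 0" by (simp add: R_def)
    \<comment> \<open>Both sides are 0 for M = 0, where \<open>M - 1\<close> is truncated.\<close>
    have M1: "of_nat M * R ^ (M - 1) = of_nat M * R ^ M / R"
      using R by (cases M) auto
    have "((\<lambda>r. of_real r ^ M * g r) has_vector_derivative
        R ^ M * dg r + of_nat M * R ^ (M - 1) * g r) (at r)"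
      unfolding R_def by (intro has_vector_derivative_mult has_vector_derivative_of_real_power g r)
    also have "R ^ M * dg r + of_nat M * R ^ (M - 1) * g r = p r / R"
      unfolding M1 p_def R_def [symmetric] using R by (simp add: field_simps)
    finally show F: "((\<lambda>r. of_real r ^ M * g r) has_vector_derivative p r / of_real r) (at r)"
      unfolding R_def .
    have I: "((\<lambda>r. inverse (of_real r ^ M)) has_vector_derivative
        - (of_nat M * R ^ (M - 1)) / (R ^ M) ^ 2) (at r)"
      unfolding R_def
      by (rule has_vector_derivative_real_field)
         (use r0 in \<open>auto intro!: derivative_eq_intros simp: field_simps power2_eq_square\<close>)
    \<comment> \<open>The flux is written as M f + r^(-M) (r^(2M+1) g'), because the Volterra
      equation provides the derivative of the weighted product. The terms with g' then cancel and
      (M^2 / r + Q r) f remains.\<close>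
    have "((\<lambda>r. of_nat M * (of_real r ^ M * g r) + inverse (of_real r ^ M) * (of_real (r ^ (2 * M + 1)) * dg r))
        has_vector_derivative of_nat M * (p r / R) + (inverse (R ^ M) * (of_real (r ^ (2 * M + 1)) * Q r * g r)
          + - (of_nat M * R ^ (M - 1)) / (R ^ M) ^ 2 * (of_real (r ^ (2 * M + 1)) * dg r))) (at r)"
      unfolding R_def
      by (intro has_vector_derivative_add has_vector_derivative_mult has_vector_derivative_mult_right
          F[unfolded R_def] I[unfolded R_def] P r)
    also have "of_nat M * (p r / R) + (inverse (R ^ M) * (of_real (r ^ (2 * M + 1)) * Q r * g r)
          + - (of_nat M * R ^ (M - 1)) / (R ^ M) ^ 2 * (of_real (r ^ (2 * M + 1)) * dg r))
        = ((of_nat M)\<^sup>2 / R + Q r * R) * (R ^ M * g r)"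
    proof -
      have N: "of_real (r ^ (2 * M + 1)) = R ^ M * R ^ M * R"
        by (simp add: R_def power_add mult_2)
      show ?thesis
        unfolding M1 N p_def R_def [symmetric] using R by (simp add: field_simps power2_eq_square)
    qed
    also have "(of_nat M)\<^sup>2 / R + Q r * R = potential n k m r"
    proof -
      have "(complex_of_nat M)\<^sup>2 = (of_int m)\<^sup>2"
        unfolding M_def by (metis of_nat_nat abs_ge_zero of_int_power power2_abs)
      thus ?thesis using n'(2)[OF r] by (simp add: potential_def Q_def R_def)
    qed
    finally have "((\<lambda>r. of_nat M * (of_real r ^ M * g r) + inverse (of_real r ^ M) * (of_real (r ^ (2 * M + 1)) * dg r))
        has_vector_derivative potential n k m r * (R ^ M * g r)) (at r)" .
    thus "(p has_vector_derivative potential n k m r * (of_real r ^ M * g r)) (at r)"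
      unfolding R_def
      by (rule has_vector_derivative_transform_within_open[where S = "{c<..<d}"])
         (use r cd in \<open>auto simp: p_def field_simps power_add mult_2 mult_2_right\<close>)
  qed
  with g ini pf show thesis using that unfolding p_def by blast
qed

lemma continuous_end_limits:
  fixes f :: "real \<Rightarrow> complex"
  assumes "c < d" "continuous_on {c..d} f"
  shows "(f \<longlongrightarrow> f c) (at_right c)" "(f \<longlongrightarrow> f d) (at_left d)"
  using continuous_on_Icc_at_rightD continuous_on_Icc_at_leftD assms by blast+

text \<open>The solution is linear in the scalar datum: two solutions differ by (g - g0) times one
  fixed mode, so continuous dependence reduces to scaling that mode.\<close>

lemma well_posedI:
  assumes ex: "\<And>m. \<exists>f. mode m f \<in> H1 (Omega \<xi> j) \<and> (\<forall>g. P m g (\<lambda>r. g * f r))"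
    and uniq: "\<And>m g f f' r. P m g f \<Longrightarrow> P m g f' \<Longrightarrow> r \<in> tau \<xi> j \<Longrightarrow> f' r = f r"
  shows "well_posed \<xi> j P h"
  unfolding well_posed_def
proof (intro allI conjI)
  fix m
  obtain f where f: "mode m f \<in> H1 (Omega \<xi> j)" "\<And>g. P m g (\<lambda>r. g * f r)"
    using ex by blast
  show "\<exists>f. P m (h m) f \<and> (\<forall>f'. P m (h m) f' \<longrightarrow> (\<forall>r\<in>tau \<xi> j. f' r = f r))"
    using f(2)[of "h m"] uniq by blast
  obtain K where K: "\<And>c. H1_norm (Omega \<xi> j) (\<lambda>z. c * mode m f z) \<le> cmod c * K"
    "\<And>c. 0 \<le> H1_norm (Omega \<xi> j) (\<lambda>z. c * mode m f z)"
    using H1_norm_cmult_bound[OF f(1)] by blast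
  show "\<exists>S. (\<forall>g. P m g (S g)) \<and>
    (\<forall>g0. ((\<lambda>g. H1_norm (Omega \<xi> j) (mode m (\<lambda>r. S g r - S g0 r))) \<longlongrightarrow> 0) (at g0))"
  proof (intro exI[of _ "\<lambda>g r. g * f r"] conjI allI f(2))
    fix g0
    have eq: "mode m (\<lambda>r. g * f r - g0 * f r) = (\<lambda>z. (g - g0) * mode m f z)" for g
      by (simp add: mode_def fun_eq_iff algebra_simps)
    have "((\<lambda>g. cmod (g - g0) * K) \<longlongrightarrow> cmod (g0 - g0) * K) (at g0)"
      by (intro tendsto_intros)
    hence lim: "((\<lambda>g. cmod (g - g0) * K) \<longlongrightarrow> 0) (at g0)" by simp
    show "((\<lambda>g. H1_norm (Omega \<xi> j) (mode m (\<lambda>r. g * f r - g0 * f r))) \<longlongrightarrow> 0) (at g0)"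
      unfolding eq by (rule Lim_null_comparison[OF _ lim]) (use K in auto)
  qed
qed

section \<open>The boundary value problems\<close>

lemma affine_condition_diff:
  fixes \<beta> a b a' b' :: "'a::comm_ring_1"
  assumes "b - \<beta> * a = s" "b' - \<beta> * a' = s"
  shows "b' - b = \<beta> * (a' - a)"
  using assms by (simp add: algebra_simps)

lemma flux_system_diff:
  assumes "flux_system n k m T f p" "flux_system n k m T g q"
  shows "flux_system n k m T (\<lambda>r. f r - g r) (\<lambda>r. p r - q r)"
  using flux_system_combine[OF assms, of 1 "-1"] by simp

lemma origin_condition_combine:
  assumes d: "0 < d" and fs: "flux_system n k m {0<..<d} f p" "flux_system n k m {0<..<d} g q"
    and o: "origin_condition m f" "origin_condition m g"
  shows "origin_condition m (\<lambda>r. a * f r + b * g r)"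
proof (cases "odd m")
  case True
  hence "((\<lambda>r. a * f r + b * g r) \<longlongrightarrow> a * 0 + b * 0) (at_right 0)"
    using o by (intro tendsto_intros) (simp_all add: origin_condition_def)
  thus ?thesis using True by (simp add: origin_condition_def)
next
  case False
  have "((\<lambda>r. a * vector_derivative f (at r) + b * vector_derivative g (at r)) \<longlongrightarrow> a * 0 + b * 0) (at_right 0)"
    using o False by (intro tendsto_intros) (simp_all add: origin_condition_def)
  moreover have "\<forall>\<^sub>F r in at_right 0. a * vector_derivative f (at r) + b * vector_derivative g (at r)
      = vector_derivative (\<lambda>r. a * f r + b * g r) (at r)"
    using eventually_Ioo_ends(2)[OF d]
  proof eventually_elim
    case (elim r)
    show ?case
      using flux_system_vector_derivative[OF fs(1) elim] flux_system_vector_derivative[OF fs(2) elim]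
        flux_system_vector_derivative[OF flux_system_combine[OF fs, of a b] elim]
      by (simp only: add_divide_distrib times_divide_eq_right)
  qed
  ultimately have "((\<lambda>r. vector_derivative (\<lambda>r. a * f r + b * g r) (at r)) \<longlongrightarrow> a * 0 + b * 0) (at_right 0)"
    by (rule Lim_transform_eventually)
  thus ?thesis using False by (simp add: origin_condition_def)
qed

text \<open>For odd \<open>m\<close> both factors tend to 0; for even \<open>m\<close> only the
  product is controlled. The result is the left-end input of \<open>homogeneous_zero\<close> with
  limit 0.\<close>

lemma origin_condition_flux_tendsto_0:
  assumes d: "0 < d" and fs: "flux_system n k m {0<..<d} f p"
    and n: "\<And>r. r \<in> {0<..<d} \<Longrightarrow> \<bar>n r\<bar> \<le> N" and o: "origin_condition m f"
  shows "((\<lambda>r. p r * cnj (f r)) \<longlongrightarrow> 0) (at_right 0)"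
proof (cases "odd m")
  case True
  hence f0: "(f \<longlongrightarrow> 0) (at_right 0)" using o by (simp add: origin_condition_def)
  have "((\<lambda>r. p r * cnj (f r)) \<longlongrightarrow> 0 * cnj 0) (at_right 0)"
    by (intro tendsto_intros f0 flux_tendsto_0_odd[OF d fs n f0])
  thus ?thesis by simp
next
  case False
  hence "((\<lambda>r. vector_derivative f (at r)) \<longlongrightarrow> 0) (at_right 0)"
    using o by (simp add: origin_condition_def)
  moreover have "f differentiable at r" if "r \<in> {0<..<d}" for r
    using fs that by (auto simp: flux_system_def intro: differentiableI_vector)
  ultimately have "((\<lambda>r. of_real r * vector_derivative f (at r) * cnj (f r)) \<longlongrightarrow> 0) (at_right 0)"
    by (intro flux_tendsto_0_even[OF d])
  moreover have "\<forall>\<^sub>F r in at_right 0. of_real r * vector_derivative f (at r) * cnj (f r) = p r * cnj (f r)"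
    using eventually_Ioo_ends(2)[OF d]
    by eventually_elim (simp add: flux_system_vector_derivative[OF fs])
  ultimately show ?thesis by (rule Lim_transform_eventually)
qed

text \<open>The regular solution at the origin provides a one-parameter family, and the condition at
  \<xi> is one scalar equation for the parameter. Uniqueness for the homogeneous problem shows that
  its coefficient is nonzero.\<close>

lemma well_posed_P11:
  assumes \<xi>: "0 < \<xi>" and nL: "C-lipschitz_on {0<..<\<xi>} n"
    and n: "\<And>r. r \<in> {0<..<\<xi>} \<Longrightarrow> \<bar>n r\<bar> \<le> N"
    and \<gamma>: "Re \<gamma> \<le> 0" "0 \<le> Re (\<gamma> * k\<^sup>2)" and \<beta>: "\<And>m. 0 < Re (\<gamma> * \<beta> 1 k m \<xi>)"
  shows "well_posed \<xi> 1 (P11 \<xi> n \<beta> k) h"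
proof (rule well_posedI)
  have tau: "tau \<xi> 1 = {0<..<\<xi>}" by (simp add: tau_def)
  have ev: "\<forall>\<^sub>F r in at_left \<xi>. r \<in> {0<..<\<xi>}" "\<forall>\<^sub>F r in at_right 0. r \<in> {0<..<\<xi>}"
    using eventually_Ioo_ends[OF \<xi>] by auto
  have endv: "end_values (at_left \<xi>) f a b \<longleftrightarrow> (f \<longlongrightarrow> a) (at_left \<xi>) \<and> (p \<longlongrightarrow> of_real \<xi> * b) (at_left \<xi>)"
    if "flux_system n k m {0<..<\<xi>} f p" for m f p a b
    using end_values_iff_flux[OF that ev(1) _ tendsto_ident_at] \<xi> by simp
  fix m
  define M where "M = nat \<bar>m\<bar>"
  obtain g dg where g: "continuous_on {0..\<xi>} g" "continuous_on {0..\<xi>} dg" "g 0 = 1" "dg 0 = 0"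
    and pf: "power_profile 0 \<xi> M (\<lambda>r. of_real r ^ M * g r)"
    and fs: "flux_system n k m {0<..<\<xi>} (\<lambda>r. of_real r ^ M * g r)
       (\<lambda>r. of_nat M * of_real r ^ M * g r + of_real r ^ (M + 1) * dg r)"
    using flux_solution_exists[OF _ \<xi> nL, of 1 0 m k] unfolding M_def by auto
  define f where "f = (\<lambda>r. of_real r ^ M * g r)"
  define p where "p = (\<lambda>r. of_nat M * of_real r ^ M * g r + of_real r ^ (M + 1) * dg r)"
  have fs: "flux_system n k m {0<..<\<xi>} f p" and pf: "power_profile 0 \<xi> M f"
    using fs pf by (simp_all add: f_def p_def)
  have cf: "continuous_on {0..\<xi>} f" and cp: "continuous_on {0..\<xi>} p"
    unfolding f_def p_def by (intro continuous_intros g)+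
  have org: "origin_condition m f"
  proof (cases "odd m")
    case True
    hence "0 < M" by (auto simp: M_def intro!: gr0I)
    thus ?thesis
      using continuous_end_limits(1)[OF \<xi> cf] True by (simp add: origin_condition_def f_def zero_power)
  next
    case False
    \<comment> \<open>The continuous extension of f' to 0. For even \<open>m\<close> either M = 0,
      where v(0) = g'(0) = 0, or M \<ge> 2, where both powers of r vanish at 0.\<close>
    define v where "v = (\<lambda>r. of_nat M * of_real r ^ (M - 1) * g r + of_real r ^ M * dg r)"
    have "continuous_on {0..\<xi>} v" unfolding v_def by (intro continuous_intros g)
    from continuous_end_limits(1)[OF \<xi> this] have "(v \<longlongrightarrow> v 0) (at_right 0)" .
    moreover have "v 0 = 0"
    proof (cases "M = 0")
      case False
      hence "M - 1 \<noteq> 0" using \<open>\<not> odd m\<close> by (auto simp: M_def)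
      thus ?thesis using False by (simp add: v_def zero_power)
    qed (simp add: v_def g)
    moreover have "\<forall>\<^sub>F r in at_right 0. v r = vector_derivative f (at r)"
      using ev(2)
    proof eventually_elim
      case (elim r)
      thus ?case
        unfolding flux_system_vector_derivative[OF fs elim] v_def p_def
        by (cases M) (auto simp: field_simps)
    qed
    ultimately have "((\<lambda>r. vector_derivative f (at r)) \<longlongrightarrow> 0) (at_right 0)"
      using Lim_transform_eventually by force
    thus ?thesis using False by (simp add: origin_condition_def)
  qed
  define D where "D = p \<xi> / of_real \<xi> - \<beta> 1 k m \<xi> * f \<xi>"
  have "D \<noteq> 0"
  proof
    assume "D = 0"
    hence p\<xi>: "p \<xi> = of_real \<xi> * (\<beta> 1 k m \<xi> * f \<xi>)" using \<xi> by (simp add: D_def field_simps)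
    have "f r = 0" if "r \<in> {0<..<\<xi>}" for r
      by (rule homogeneous_zero[OF fs _ \<xi> n \<gamma> \<beta> origin_condition_flux_tendsto_0[OF \<xi> fs n org]
            _ continuous_end_limits(2)[OF \<xi> cf] _ that])
         (use continuous_end_limits(2)[OF \<xi> cp] p\<xi> in auto)
    \<comment> \<open>The contradiction is drawn from \<open>g\<close>, whose value at 0 is 1;
      \<open>f\<close> itself tends to 0 there as soon as M > 0.\<close>
    hence "\<forall>\<^sub>F r in at_right 0. g r = 0"
      using ev(2) by (auto simp: f_def elim!: eventually_mono)
    moreover have "(g \<longlongrightarrow> 1) (at_right 0)" using continuous_end_limits(1)[OF \<xi> g(1)] g by simp
    ultimately show False
      using tendsto_unique[OF trivial_limit_at_right_real tendsto_eventually] zero_neq_one by blast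
  qed
  have sol: "P11 \<xi> n \<beta> k m s (\<lambda>r. s * (f r / D))" for s
  proof -
    \<comment> \<open>Scalar multiples are taken as linear combinations of \<open>f\<close> with
      itself, so that the combination lemmas apply.\<close>
    have eq: "(\<lambda>r. s / D * f r + 0 * f r) = (\<lambda>r. s * (f r / D))" by auto
    have fs': "flux_system n k m {0<..<\<xi>} (\<lambda>r. s * (f r / D)) (\<lambda>r. s / D * p r + 0 * p r)"
      using flux_system_combine[OF fs fs, of "s / D" 0] unfolding eq .
    have "radial_solution \<xi> n 1 k m (\<lambda>r. s * (f r / D))"
      using radial_solutionI[OF tau _ \<xi> _ fs'] power_profile_combine[OF pf pf, of "s / D" 0]
      unfolding eq M_def by simp
    moreover have "origin_condition m (\<lambda>r. s * (f r / D))"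
      using origin_condition_combine[OF \<xi> fs fs org org, of "s / D" 0] unfolding eq .
    moreover have "end_values (at_left \<xi>) (\<lambda>r. s * (f r / D)) (s * (f \<xi> / D)) (s / D * (p \<xi> / of_real \<xi>))"
      unfolding endv[OF fs']
    proof
      show "((\<lambda>r. s * (f r / D)) \<longlongrightarrow> s * (f \<xi> / D)) (at_left \<xi>)"
        by (intro tendsto_intros continuous_end_limits(2)[OF \<xi> cf] \<open>D \<noteq> 0\<close>)
      have "((\<lambda>r. s / D * p r + 0 * p r) \<longlongrightarrow> s / D * p \<xi> + 0 * p \<xi>) (at_left \<xi>)"
        by (intro tendsto_intros continuous_end_limits(2)[OF \<xi> cp])
      thus "((\<lambda>r. s / D * p r + 0 * p r) \<longlongrightarrow> of_real \<xi> * (s / D * (p \<xi> / of_real \<xi>))) (at_left \<xi>)"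
        using \<xi> by simp
    qed
    moreover
    have "s / D * (p \<xi> / of_real \<xi>) - \<beta> 1 k m \<xi> * (s * (f \<xi> / D)) = s / D * D"
      unfolding D_def by (simp add: right_diff_distrib)
    hence "s / D * (p \<xi> / of_real \<xi>) - \<beta> 1 k m \<xi> * (s * (f \<xi> / D)) = s"
      using \<open>D \<noteq> 0\<close> by simp
    ultimately show ?thesis unfolding P11_def by blast
  qed
  have "mode m (\<lambda>r. f r / D) \<in> H1 (Omega \<xi> 1)"
    using sol[of 1] by (simp add: P11_def radial_solution_def)
  with sol show "\<exists>f. mode m f \<in> H1 (Omega \<xi> 1) \<and> (\<forall>g. P11 \<xi> n \<beta> k m g (\<lambda>r. g * f r))" by blast
next
  have tau: "tau \<xi> 1 = {0<..<\<xi>}" by (simp add: tau_def)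
  fix m s f f' r
  assume P: "P11 \<xi> n \<beta> k m s f" "P11 \<xi> n \<beta> k m s f'" and r: "r \<in> tau \<xi> 1"
  let ?p = "\<lambda>f r. of_real r * vector_derivative f (at r) :: complex"
  have fs: "flux_system n k m {0<..<\<xi>} f (?p f)" "flux_system n k m {0<..<\<xi>} f' (?p f')"
    using P unfolding P11_def by (blast intro: radial_solution_flux[OF tau order_refl])+
  have fsd: "flux_system n k m {0<..<\<xi>} (\<lambda>r. f' r - f r) (\<lambda>r. ?p f' r - ?p f r)"
    by (rule flux_system_diff[OF fs(2,1)])
  have org: "origin_condition m (\<lambda>r. f' r - f r)"
    using origin_condition_combine[OF \<xi> fs(2,1), of 1 "-1"] P unfolding P11_def by simp
  obtain a b where 1: "end_values (at_left \<xi>) f a b" "b - \<beta> 1 k m \<xi> * a = s"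
    using P(1) unfolding P11_def by blast
  obtain a' b' where 2: "end_values (at_left \<xi>) f' a' b'" "b' - \<beta> 1 k m \<xi> * a' = s"
    using P(2) unfolding P11_def by blast
  have lim: "((\<lambda>r. f' r - f r) \<longlongrightarrow> a' - a) (at_left \<xi>)"
    using 1 2 unfolding end_values_def by (intro tendsto_intros) auto
  have "((\<lambda>r. ?p f' r - ?p f r) \<longlongrightarrow> of_real \<xi> * b' - of_real \<xi> * b) (at_left \<xi>)"
    using 1 2 unfolding end_values_def by (intro tendsto_intros) auto
  also have "of_real \<xi> * b' - of_real \<xi> * b = of_real \<xi> * (\<beta> 1 k m \<xi> * (a' - a))"
    unfolding affine_condition_diff[OF 1(2) 2(2), symmetric] by (rule right_diff_distrib [symmetric])
  finally have lim': "((\<lambda>r. ?p f' r - ?p f r) \<longlongrightarrow> \<dots>) (at_left \<xi>)" .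
  have "f' r - f r = 0"
    by (rule homogeneous_zero[OF fsd _ \<xi> n \<gamma> \<beta> origin_condition_flux_tendsto_0[OF \<xi> fsd n org] _ lim lim'])
       (use r tau in auto)
  thus "f' r = f r" by simp
qed

text \<open>Data at both circles are allowed at once, so the two annulus problems become the cases s
  = 0 and t = 0 of one statement.\<close>

definition two_point ::
    "real \<Rightarrow> (real \<Rightarrow> real) \<Rightarrow> coeffs \<Rightarrow> complex \<Rightarrow> int \<Rightarrow> complex \<Rightarrow> complex \<Rightarrow> (real \<Rightarrow> complex) \<Rightarrow> bool" where
  "two_point \<xi> n \<beta> k m s t f \<longleftrightarrow> radial_solution \<xi> n 2 k m f \<and>
     (\<exists>a b. end_values (at_right \<xi>) f a b \<and> - b - \<beta> 2 k m \<xi> * a = s) \<and>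
     (\<exists>a b. end_values (at_left 1) f a b \<and> b - \<beta> 2 k m 1 * a = t)"

locale annulus =
  fixes \<xi> C N :: real and n :: "real \<Rightarrow> real" and k \<gamma> :: complex and \<beta> :: coeffs
  assumes \<xi>: "0 < \<xi>" "\<xi> < 1" and nL: "C-lipschitz_on {\<xi><..<1} n"
    and n: "\<And>r. r \<in> {\<xi><..<1} \<Longrightarrow> \<bar>n r\<bar> \<le> N"
    and \<gamma>: "Re \<gamma> \<le> 0" "0 \<le> Re (\<gamma> * k\<^sup>2)"
    and \<beta>: "\<And>m. 0 < Re (\<gamma> * \<beta> 2 k m \<xi>)" "\<And>m. 0 < Re (\<gamma> * \<beta> 2 k m 1)"
begin

lemma tau2: "tau \<xi> 2 = {\<xi><..<1}" by (simp add: tau_def)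

lemma end_values_iff:
  assumes "flux_system n k m {\<xi><..<1} f p"
  shows "end_values (at_left 1) f a b \<longleftrightarrow> (f \<longlongrightarrow> a) (at_left 1) \<and> (p \<longlongrightarrow> b) (at_left 1)"
    and "end_values (at_right \<xi>) f a b \<longleftrightarrow> (f \<longlongrightarrow> a) (at_right \<xi>) \<and> (p \<longlongrightarrow> of_real \<xi> * b) (at_right \<xi>)"
  using end_values_iff_flux[OF assms eventually_Ioo_ends(1)[OF \<xi>(2)] _ tendsto_ident_at, of a b]
    end_values_iff_flux[OF assms eventually_Ioo_ends(2)[OF \<xi>(2)] _ tendsto_ident_at, of a b] \<xi> by auto

text \<open>At the inner circle the derivative enters the boundary condition with a minus sign, so
  the energy there equals -\<xi> \<bar>a\<bar>^2 Re (\<gamma> \<beta>) and is nonpositive, as the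
  left end requires.\<close>

lemma homogeneous:
  assumes fs: "flux_system n k m {\<xi><..<1} f p"
    and l: "(f \<longlongrightarrow> a) (at_right \<xi>)" "(p \<longlongrightarrow> - of_real \<xi> * (\<beta> 2 k m \<xi> * a)) (at_right \<xi>)"
    and r: "(f \<longlongrightarrow> b) (at_left 1)" "(p \<longlongrightarrow> \<beta> 2 k m 1 * b) (at_left 1)"
    and x: "x \<in> {\<xi><..<1}"
  shows "f x = 0"
proof (rule homogeneous_zero[OF fs _ \<xi>(2) n \<gamma> \<beta>(2) _ _ r(1) _ x])
  show "((\<lambda>r. p r * cnj (f r)) \<longlongrightarrow> (- of_real \<xi> * (\<beta> 2 k m \<xi> * a)) * cnj a) (at_right \<xi>)"
    by (intro tendsto_intros l)
  have "\<gamma> * ((- of_real \<xi> * (\<beta> 2 k m \<xi> * a)) * cnj a) = of_real (- \<xi> * (cmod a)\<^sup>2) * (\<gamma> * \<beta> 2 k m \<xi>)"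
    using complex_norm_square[of a] by (simp add: algebra_simps)
  also have "Re \<dots> = - \<xi> * (cmod a)\<^sup>2 * Re (\<gamma> * \<beta> 2 k m \<xi>)"
    by (simp only: Re_complex_of_real Im_complex_of_real times_complex.sel(1)[of "of_real _"])
  also have "\<dots> \<le> 0"
    using \<xi> \<beta>(1)[of m] by (intro mult_nonpos_nonneg) (auto simp del: times_complex.sel)
  finally show "Re (\<gamma> * (- of_real \<xi> * (\<beta> 2 k m \<xi> * a) * cnj a)) \<le> 0" .
qed (use \<xi> r in auto)

text \<open>At \<xi> > 0 the relations f = r^M g and p = M f + r^(M+1) g' can be solved for
  \<open>g\<close> and \<open>g'\<close>, so any values of \<open>f\<close> and \<open>p\<close> can
  be prescribed.\<close>

lemma cauchy_solution:
  obtains f p where "power_profile \<xi> 1 (nat \<bar>m\<bar>) f" "flux_system n k m {\<xi><..<1} f p"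
    "continuous_on {\<xi>..1} f" "continuous_on {\<xi>..1} p" "f \<xi> = A" "p \<xi> = B"
proof -
  let ?M = "nat \<bar>m\<bar>" and ?X = "complex_of_real \<xi>"
  have X: "?X \<noteq> 0" using \<xi> by simp
  obtain g dg where g: "continuous_on {\<xi>..1} g" "continuous_on {\<xi>..1} dg"
    and ini: "g \<xi> = A / ?X ^ ?M" "dg \<xi> = (if \<xi> = 0 then 0 else (B - of_nat ?M * A) / ?X ^ (?M + 1))"
    and pf: "power_profile \<xi> 1 ?M (\<lambda>r. of_real r ^ ?M * g r)"
    and fs: "flux_system n k m {\<xi><..<1} (\<lambda>r. of_real r ^ ?M * g r)
       (\<lambda>r. of_nat ?M * of_real r ^ ?M * g r + of_real r ^ (?M + 1) * dg r)"
    by (rule flux_solution_exists[OF less_imp_le[OF \<xi>(1)] \<xi>(2) nL])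
  show thesis
  proof (rule that[OF pf fs])
    show "?X ^ ?M * g \<xi> = A" using X ini(1) by simp
    have 1: "?X ^ (?M + 1) * dg \<xi> = B - of_nat ?M * A" using X ini(2) \<xi> by simp
    have 2: "of_nat ?M * ?X ^ ?M * g \<xi> = of_nat ?M * A" using X ini(1) by simp
    show "of_nat ?M * ?X ^ ?M * g \<xi> + ?X ^ (?M + 1) * dg \<xi> = B" unfolding 1 2 by simp
  qed (intro continuous_intros g)+
qed

lemma two_point_unique:
  assumes P: "two_point \<xi> n \<beta> k m s t f" "two_point \<xi> n \<beta> k m s t f'" and r: "r \<in> tau \<xi> 2"
  shows "f' r = f r"
proof -
  let ?p = "\<lambda>f r. of_real r * vector_derivative f (at r) :: complex"
  have fs: "flux_system n k m {\<xi><..<1} f (?p f)" "flux_system n k m {\<xi><..<1} f' (?p f')"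
    using P unfolding two_point_def by (blast intro: radial_solution_flux[OF tau2 less_imp_le[OF \<xi>(1)]])+
  have fsd: "flux_system n k m {\<xi><..<1} (\<lambda>r. f' r - f r) (\<lambda>r. ?p f' r - ?p f r)"
    by (rule flux_system_diff[OF fs(2,1)])
  obtain a b c d where 1: "end_values (at_right \<xi>) f a b" "- b - \<beta> 2 k m \<xi> * a = s"
    "end_values (at_left 1) f c d" "d - \<beta> 2 k m 1 * c = t"
    using P(1) unfolding two_point_def by blast
  obtain a' b' c' d' where 2: "end_values (at_right \<xi>) f' a' b'" "- b' - \<beta> 2 k m \<xi> * a' = s"
    "end_values (at_left 1) f' c' d'" "d' - \<beta> 2 k m 1 * c' = t"
    using P(2) unfolding two_point_def by blast
  have lim: "((\<lambda>r. f' r - f r) \<longlongrightarrow> a' - a) (at_right \<xi>)"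
    "((\<lambda>r. f' r - f r) \<longlongrightarrow> c' - c) (at_left 1)"
    using 1 2 unfolding end_values_def by (intro tendsto_intros; simp)+
  have limp: "((\<lambda>r. ?p f' r - ?p f r) \<longlongrightarrow> of_real \<xi> * b' - of_real \<xi> * b) (at_right \<xi>)"
    "((\<lambda>r. ?p f' r - ?p f r) \<longlongrightarrow> of_real 1 * d' - of_real 1 * d) (at_left 1)"
    using 1 2 unfolding end_values_def by (intro tendsto_intros; simp)+
  have "of_real \<xi> * b' - of_real \<xi> * b = - of_real \<xi> * (- b' - - b)"
    by (simp add: right_diff_distrib)
  hence eq1: "of_real \<xi> * b' - of_real \<xi> * b = - of_real \<xi> * (\<beta> 2 k m \<xi> * (a' - a))"
    unfolding affine_condition_diff[OF 1(2) 2(2)] .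
  have eq2: "of_real 1 * d' - of_real 1 * d = \<beta> 2 k m 1 * (c' - c)"
    using affine_condition_diff[OF 1(4) 2(4)] by simp
  have "f' r - f r = 0"
    using homogeneous[OF fsd lim(1) limp(1)[unfolded eq1] lim(2) limp(2)[unfolded eq2]] r tau2 by blast
  thus ?thesis by simp
qed

text \<open>Shooting from \<xi>: \<open>y\<close> satisfies the homogeneous condition there and
  \<open>z\<close> the inhomogeneous one, so every \<open>z + c y\<close> is correct at \<xi>.
  Uniqueness gives D \<noteq> 0, and \<open>c\<close> is adjusted at the outer circle.\<close>

lemma two_point_exists:
  obtains f where "\<And>g. two_point \<xi> n \<beta> k m (g * s) (g * t) (\<lambda>r. g * f r)"
proof -
  obtain y q where y: "power_profile \<xi> 1 (nat \<bar>m\<bar>) y" "flux_system n k m {\<xi><..<1} y q"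
    "continuous_on {\<xi>..1} y" "continuous_on {\<xi>..1} q" "y \<xi> = 1" "q \<xi> = - of_real \<xi> * \<beta> 2 k m \<xi>"
    by (rule cauchy_solution)
  obtain z w where z: "power_profile \<xi> 1 (nat \<bar>m\<bar>) z" "flux_system n k m {\<xi><..<1} z w"
    "continuous_on {\<xi>..1} z" "continuous_on {\<xi>..1} w" "z \<xi> = 0" "w \<xi> = - of_real \<xi> * s"
    by (rule cauchy_solution)
  define D where "D = q 1 - \<beta> 2 k m 1 * y 1"
  have "D \<noteq> 0"
  proof
    assume "D = 0"
    hence q1: "q 1 = \<beta> 2 k m 1 * y 1" by (simp add: D_def)
    have "y r = 0" if "r \<in> {\<xi><..<1}" for r
      by (rule homogeneous[OF y(2) _ _ _ _ that, of 1 "y 1"])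
         (use continuous_end_limits[OF \<xi>(2) y(3)] continuous_end_limits[OF \<xi>(2) y(4)] y(5,6) q1 in auto)
    hence "\<forall>\<^sub>F r in at_right \<xi>. y r = 0"
      using eventually_Ioo_ends(2)[OF \<xi>(2)] by (auto elim!: eventually_mono)
    moreover have "(y \<longlongrightarrow> 1) (at_right \<xi>)" using continuous_end_limits(1)[OF \<xi>(2) y(3)] y by simp
    ultimately show False
      using tendsto_unique[OF trivial_limit_at_right_real tendsto_eventually] zero_neq_one by blast
  qed
  \<comment> \<open>The solution of the outer condition for \<open>z + c y\<close>, whose left-hand
    side is that of \<open>z\<close> plus c D.\<close>
  define c where "c = (t - (w 1 - \<beta> 2 k m 1 * z 1)) / D"
  show thesis
  proof (rule that[of "\<lambda>r. z r + c * y r"])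
    fix g
    define f where "f = (\<lambda>r. g * z r + g * c * y r)"
    define p where "p = (\<lambda>r. g * w r + g * c * q r)"
    have fs: "flux_system n k m {\<xi><..<1} f p"
      unfolding f_def p_def by (rule flux_system_combine[OF z(2) y(2)])
    have "radial_solution \<xi> n 2 k m f"
      by (rule radial_solutionI[OF tau2 _ \<xi>(2) _ fs])
         (use \<xi> power_profile_combine[OF z(1) y(1)] in \<open>auto simp: f_def\<close>)
    moreover have cont: "continuous_on {\<xi>..1} f" "continuous_on {\<xi>..1} p"
      unfolding f_def p_def by (intro continuous_intros y z)+
    have "end_values (at_right \<xi>) f (f \<xi>) (p \<xi> / of_real \<xi>)" "end_values (at_left 1) f (f 1) (p 1)"
      unfolding end_values_iff[OF fs]
      using continuous_end_limits[OF \<xi>(2) cont(1)] continuous_end_limits[OF \<xi>(2) cont(2)] \<xi> by auto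
    moreover have "- (p \<xi> / of_real \<xi>) - \<beta> 2 k m \<xi> * f \<xi> = g * s"
      using \<xi> by (simp add: p_def f_def y z field_simps)
    moreover have "p 1 - \<beta> 2 k m 1 * f 1 = g * t"
    proof -
      have "p 1 - \<beta> 2 k m 1 * f 1 = g * (w 1 - \<beta> 2 k m 1 * z 1) + g * (c * D)"
        by (simp add: p_def f_def D_def algebra_simps)
      also have "c * D = t - (w 1 - \<beta> 2 k m 1 * z 1)" using \<open>D \<noteq> 0\<close> by (simp add: c_def)
      finally show ?thesis by (simp add: algebra_simps)
    qed
    ultimately have "two_point \<xi> n \<beta> k m (g * s) (g * t) f" unfolding two_point_def by blast
    thus "two_point \<xi> n \<beta> k m (g * s) (g * t) (\<lambda>r. g * (z r + c * y r))"
      by (simp add: f_def algebra_simps)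
  qed
qed

lemma well_posed_two_point:
  "well_posed \<xi> 2 (\<lambda>m g. two_point \<xi> n \<beta> k m (g * s) (g * t)) h"
proof (rule well_posedI)
  fix m
  obtain f where f: "\<And>g. two_point \<xi> n \<beta> k m (g * s) (g * t) (\<lambda>r. g * f r)"
    using two_point_exists by blast
  from f[of 1] have "mode m f \<in> H1 (Omega \<xi> 2)"
    by (simp add: two_point_def radial_solution_def)
  with f show "\<exists>f. mode m f \<in> H1 (Omega \<xi> 2) \<and>
      (\<forall>g. two_point \<xi> n \<beta> k m (g * s) (g * t) (\<lambda>r. g * f r))" by blast
qed (rule two_point_unique)

lemma well_posed_P21_P22:
  "well_posed \<xi> 2 (P21 \<xi> n \<beta> k) h" "well_posed \<xi> 2 (P22 \<xi> n \<beta> k) h"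
proof -
  have 1: "P21 \<xi> n \<beta> k = (\<lambda>m g. two_point \<xi> n \<beta> k m (g * 0) (g * 1))"
    and 2: "P22 \<xi> n \<beta> k = (\<lambda>m g. two_point \<xi> n \<beta> k m (g * 1) (g * 0))"
    by (auto simp: fun_eq_iff P21_def P22_def two_point_def)
  show "well_posed \<xi> 2 (P21 \<xi> n \<beta> k) h" unfolding 1 by (rule well_posed_two_point)
  show "well_posed \<xi> 2 (P22 \<xi> n \<beta> k) h" unfolding 2 by (rule well_posed_two_point)
qed

end

section \<open>A common multiplier for all three problems\<close>

lemma well_posed_all:
  assumes \<xi>: "0 < \<xi>" "\<xi> < 1" and ri: "refractive_index \<xi> n"
    and \<gamma>: "Re \<gamma> \<le> 0" "0 \<le> Re (\<gamma> * k\<^sup>2)"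
    and \<beta>: "\<And>j x m. (j, x) \<in> JJ \<xi> \<Longrightarrow> 0 < Re (\<gamma> * \<beta> j k m x)"
  shows "well_posed \<xi> 1 (P11 \<xi> n \<beta> k) h \<and> well_posed \<xi> 2 (P21 \<xi> n \<beta> k) h' \<and>
    well_posed \<xi> 2 (P22 \<xi> n \<beta> k) h''"
proof -
  define N where "N = Sup (n ` {0<..<1})"
  have nb: "\<bar>n r\<bar> \<le> N" if "r \<in> {0<..<1}" for r
  proof -
    have "Inf (n ` {0<..<1}) \<le> n r" "n r \<le> N" "0 < Inf (n ` {0<..<1})"
      using ri that by (auto simp: refractive_index_def N_def intro!: cINF_lower cSUP_upper)
    thus ?thesis by simp
  qed
  obtain C1 where C1: "C1-lipschitz_on {0<..<\<xi>} n"
    using ri unfolding refractive_index_def by (force simp: tau_def)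
  obtain C2 where C2: "C2-lipschitz_on {\<xi><..<1} n"
    using ri unfolding refractive_index_def by (force simp: tau_def)
  interpret annulus \<xi> C2 N n k \<gamma> \<beta>
    by unfold_locales (use \<xi> C2 nb \<gamma> \<beta> in \<open>auto simp: JJ_def simp del: times_complex.sel\<close>)
  have "(1, \<xi>) \<in> JJ \<xi>" by (simp add: JJ_def)
  note assms(6)[OF this]
  hence "well_posed \<xi> 1 (P11 \<xi> n \<beta> k) h"
    by (intro well_posed_P11[OF \<xi>(1) C1 _ \<gamma>, where N = N]) (use \<xi> nb in auto)
  with well_posed_P21_P22 show ?thesis by blast
qed

text \<open>Testing with harmonics gives the sign of each coefficient; since the sign depends on
  \<open>k\<close> alone, one \<gamma> serves all modes and circles. The orientation \<sigma> is 1
  in the closed upper half plane and -1 in the lower one, which lets both parts of the theorem share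
  the argument.\<close>

lemma multiplier_sign:
  assumes \<xi>: "0 < \<xi>" and k: "k \<noteq> 0" "Im k \<noteq> 0 \<or> Re k \<noteq> 0" and \<mu>: "Im k \<noteq> 0 \<Longrightarrow> 0 < \<mu>"
    and \<sigma>: "\<sigma> = 1 \<or> \<sigma> = -1" "0 \<le> \<sigma> * Im k"
    and H: "\<And>j x u. (j, x) \<in> JJ \<xi> \<Longrightarrow> u \<in> H_half x \<Longrightarrow> \<not> circle_null x u \<Longrightarrow>
      (Im k \<noteq> 0 \<longrightarrow> - Re (circle_pairing x (mult_op (\<lambda>m. \<beta> j k m x) x u) u) \<ge> \<mu> * (circle_norm x u)\<^sup>2) \<and>
      (Re k \<noteq> 0 \<longrightarrow> \<sigma> * sgn (Re k) * Im (circle_pairing x (mult_op (\<lambda>m. \<beta> j k m x) x u) u) > 0)"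
  obtains \<gamma> where "Re \<gamma> \<le> 0" "0 \<le> Re (\<gamma> * k\<^sup>2)"
    "\<And>j x m. (j, x) \<in> JJ \<xi> \<Longrightarrow> 0 < Re (\<gamma> * \<beta> j k m x)"
proof -
  have H': "(Im k \<noteq> 0 \<longrightarrow> Re (\<beta> j k m x) < 0) \<and> (Re k \<noteq> 0 \<longrightarrow> 0 < \<sigma> * sgn (Re k) * Im (\<beta> j k m x))"
    if jx: "(j, x) \<in> JJ \<xi>" for j x m
  proof -
    have x: "0 < x" using jx \<xi> by (auto simp: JJ_def)
    define c where "c = 2 * pi * x"
    have c: "0 < c" using x by (simp add: c_def)
    have "(Im k \<noteq> 0 \<longrightarrow> \<mu> * c \<le> - (c * Re (\<beta> j k m x))) \<and>
        (Re k \<noteq> 0 \<longrightarrow> \<sigma> * sgn (Re k) * (c * Im (\<beta> j k m x)) > 0)"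
      using H[OF jx harmonic_in_H_half[OF x] harmonic_not_null[OF x], of m]
      unfolding circle_pairing_harmonic[OF x] circle_norm_harmonic[OF x] c_def [symmetric] by simp
    moreover have "\<sigma> * sgn (Re k) * (c * Im (\<beta> j k m x)) = c * (\<sigma> * sgn (Re k) * Im (\<beta> j k m x))" by simp
    moreover have "Re (\<beta> j k m x) < 0" if "Im k \<noteq> 0" "\<mu> * c \<le> - (c * Re (\<beta> j k m x))"
    proof -
      have "c * (\<mu> + Re (\<beta> j k m x)) \<le> 0" using that by (simp add: algebra_simps)
      hence "\<mu> + Re (\<beta> j k m x) \<le> 0" using c by (simp add: mult_le_0_iff)
      thus ?thesis using \<mu>[OF that(1)] by simp
    qed
    ultimately show ?thesis using c by (auto simp: zero_less_mult_iff)
  qed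
  show thesis
  proof (cases "Re k = 0")
    case True
    hence "Im k \<noteq> 0" using k by auto
    with H' True show thesis
      \<comment> \<open>For Re k = 0 one has k^2 = -(Im k)^2, so \<gamma> = -1 makes Re (\<gamma>
        k^2) nonnegative and reverses the sign of Re \<beta>.\<close>
      by (intro that[of "-1"]) (auto simp: power2_eq_square)
  next
    case False
    \<comment> \<open>A purely imaginary multiplier reads off imaginary parts: Re (\<gamma> \<beta>)
      = \<sigma> sgn (Re k) Im \<beta>, and Re (\<gamma> k^2) = 2 \<sigma> Im k \<bar>Re
      k\<bar>.\<close>
    define \<gamma> where "\<gamma> = Complex 0 (- (\<sigma> * sgn (Re k)))"
    show thesis
    proof (rule that[of \<gamma>])
      show "Re \<gamma> \<le> 0" by (simp add: \<gamma>_def)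
      have "Re (\<gamma> * k\<^sup>2) = 2 * (\<sigma> * Im k) * (sgn (Re k) * Re k)"
        by (simp add: \<gamma>_def power2_eq_square)
      thus "0 \<le> Re (\<gamma> * k\<^sup>2)" using \<sigma>(2) by (simp add: sgn_mult_self_eq abs_sgn [symmetric] mult.commute[of "sgn _"])
      show "0 < Re (\<gamma> * \<beta> j k m x)" if "(j, x) \<in> JJ \<xi>" for j x m
        using H'[OF that, of m] False by (simp add: \<gamma>_def)
    qed
  qed
qed

theorem lemma4:
  fixes \<xi> :: real and n :: "real \<Rightarrow> real"
    and \<beta> :: "nat \<Rightarrow> complex \<Rightarrow> int \<Rightarrow> real \<Rightarrow> complex"
    and h :: "nat \<Rightarrow> nat \<Rightarrow> complex \<Rightarrow> int \<Rightarrow> complex"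
  assumes "0 < \<xi>" and "\<xi> < 1"
    and "refractive_index \<xi> n"
    and "\<forall>k m. k \<noteq> 0 \<longrightarrow> h 1 1 k m \<noteq> 0 \<and> h 2 1 k m \<noteq> 0 \<and> h 2 2 k m \<noteq> 0"
    and "\<forall>k. k \<noteq> 0 \<longrightarrow> (\<forall>(j, x)\<in>JJ \<xi>. bounded_linear_half x (mult_op (\<lambda>m. \<beta> j k m x) x))"
    and "\<forall>k. k \<noteq> 0 \<longrightarrow> bounded_antilinear_form \<xi> (h 1 1 k) \<and>
           bounded_antilinear_form 1 (h 2 1 k) \<and> bounded_antilinear_form \<xi> (h 2 2 k)"
  shows
    "((\<exists>\<mu> :: complex \<Rightarrow> real.
        (\<forall>k. k \<noteq> 0 \<and> Im k \<ge> 0 \<longrightarrow> \<mu> k \<ge> 0) \<and> (\<forall>k. Im k > 0 \<longrightarrow> \<mu> k > 0) \<and>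
        (\<forall>(j, x)\<in>JJ \<xi>. \<forall>k. k \<noteq> 0 \<and> Im k \<ge> 0 \<longrightarrow>
          (\<forall>u\<in>H_half x. \<not> circle_null x u \<longrightarrow>
            (Im k > 0 \<longrightarrow>
               - Re (circle_pairing x (mult_op (\<lambda>m. \<beta> j k m x) x u) u) \<ge> \<mu> k * (circle_norm x u)\<^sup>2) \<and>
            (Re k \<noteq> 0 \<longrightarrow>
               sgn (Re k) * Im (circle_pairing x (mult_op (\<lambda>m. \<beta> j k m x) x u) u) > 0))))
      \<longrightarrow> (\<forall>k. k \<noteq> 0 \<and> Im k \<ge> 0 \<longrightarrow>
            well_posed \<xi> 1 (P11 \<xi> n \<beta> k) (h 1 1 k) \<and>
            well_posed \<xi> 2 (P21 \<xi> n \<beta> k) (h 2 1 k) \<and>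
            well_posed \<xi> 2 (P22 \<xi> n \<beta> k) (h 2 2 k))) \<and>
     ((\<exists>\<mu> :: complex \<Rightarrow> real.
        (\<forall>k. k \<noteq> 0 \<and> Im k \<le> 0 \<longrightarrow> \<mu> k \<ge> 0) \<and> (\<forall>k. Im k < 0 \<longrightarrow> \<mu> k > 0) \<and>
        (\<forall>(j, x)\<in>JJ \<xi>. \<forall>k. Im k < 0 \<longrightarrow>
          (\<forall>u\<in>H_half x. \<not> circle_null x u \<longrightarrow>
            - Re (circle_pairing x (mult_op (\<lambda>m. \<beta> j k m x) x u) u) \<ge> \<mu> k * (circle_norm x u)\<^sup>2 \<and>
            (Re k \<noteq> 0 \<longrightarrow>
               - sgn (Re k) * Im (circle_pairing x (mult_op (\<lambda>m. \<beta> j k m x) x u) u) > 0))))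
      \<longrightarrow> (\<forall>k. Im k < 0 \<longrightarrow>
            well_posed \<xi> 1 (P11 \<xi> n \<beta> k) (h 1 1 k) \<and>
            well_posed \<xi> 2 (P21 \<xi> n \<beta> k) (h 2 1 k) \<and>
            well_posed \<xi> 2 (P22 \<xi> n \<beta> k) (h 2 2 k)))"
proof (intro conjI impI allI)
  fix k :: complex
  assume "\<exists>\<mu> :: complex \<Rightarrow> real.
        (\<forall>k. k \<noteq> 0 \<and> Im k \<ge> 0 \<longrightarrow> \<mu> k \<ge> 0) \<and> (\<forall>k. Im k > 0 \<longrightarrow> \<mu> k > 0) \<and>
        (\<forall>(j, x)\<in>JJ \<xi>. \<forall>k. k \<noteq> 0 \<and> Im k \<ge> 0 \<longrightarrow>
          (\<forall>u\<in>H_half x. \<not> circle_null x u \<longrightarrow>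
            (Im k > 0 \<longrightarrow>
               - Re (circle_pairing x (mult_op (\<lambda>m. \<beta> j k m x) x u) u) \<ge> \<mu> k * (circle_norm x u)\<^sup>2) \<and>
            (Re k \<noteq> 0 \<longrightarrow>
               sgn (Re k) * Im (circle_pairing x (mult_op (\<lambda>m. \<beta> j k m x) x u) u) > 0)))"
    and k: "k \<noteq> 0 \<and> Im k \<ge> 0"
  then obtain \<mu> :: "complex \<Rightarrow> real" where \<mu>: "\<forall>k. Im k > 0 \<longrightarrow> \<mu> k > 0"
    and H: "\<forall>(j, x)\<in>JJ \<xi>. \<forall>k. k \<noteq> 0 \<and> Im k \<ge> 0 \<longrightarrow>
          (\<forall>u\<in>H_half x. \<not> circle_null x u \<longrightarrow>
            (Im k > 0 \<longrightarrow>
               - Re (circle_pairing x (mult_op (\<lambda>m. \<beta> j k m x) x u) u) \<ge> \<mu> k * (circle_norm x u)\<^sup>2) \<and>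
            (Re k \<noteq> 0 \<longrightarrow>
               sgn (Re k) * Im (circle_pairing x (mult_op (\<lambda>m. \<beta> j k m x) x u) u) > 0))"
    by blast
  obtain \<gamma> where \<gamma>: "Re \<gamma> \<le> 0" "0 \<le> Re (\<gamma> * k\<^sup>2)"
    "\<And>j x m. (j, x) \<in> JJ \<xi> \<Longrightarrow> 0 < Re (\<gamma> * \<beta> j k m x)"
  proof (rule multiplier_sign[of \<xi> k "\<mu> k" 1 \<beta>])
    show "Im k \<noteq> 0 \<or> Re k \<noteq> 0" using k by (auto simp: complex_eq_iff)
    show "0 < \<mu> k" if "Im k \<noteq> 0" using that \<mu> k by simp
    fix j x u assume u: "(j, x) \<in> JJ \<xi>" "u \<in> H_half x" "\<not> circle_null x u"
    thus "(Im k \<noteq> 0 \<longrightarrow> - Re (circle_pairing x (mult_op (\<lambda>m. \<beta> j k m x) x u) u) \<ge> \<mu> k * (circle_norm x u)\<^sup>2) \<and>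
      (Re k \<noteq> 0 \<longrightarrow> 1 * sgn (Re k) * Im (circle_pairing x (mult_op (\<lambda>m. \<beta> j k m x) x u) u) > 0)"
      using bspec[OF H u(1)] k by simp
  qed (use assms(1) k in auto)
  have "well_posed \<xi> 1 (P11 \<xi> n \<beta> k) (h 1 1 k) \<and> well_posed \<xi> 2 (P21 \<xi> n \<beta> k) (h 2 1 k) \<and>
      well_posed \<xi> 2 (P22 \<xi> n \<beta> k) (h 2 2 k)"
    by (rule well_posed_all[where \<gamma> = \<gamma>]) (rule assms \<gamma> | assumption)+
  thus "well_posed \<xi> 1 (P11 \<xi> n \<beta> k) (h 1 1 k)" "well_posed \<xi> 2 (P21 \<xi> n \<beta> k) (h 2 1 k)"
    "well_posed \<xi> 2 (P22 \<xi> n \<beta> k) (h 2 2 k)"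
    by blast+
next
  fix k :: complex
  assume "\<exists>\<mu> :: complex \<Rightarrow> real.
        (\<forall>k. k \<noteq> 0 \<and> Im k \<le> 0 \<longrightarrow> \<mu> k \<ge> 0) \<and> (\<forall>k. Im k < 0 \<longrightarrow> \<mu> k > 0) \<and>
        (\<forall>(j, x)\<in>JJ \<xi>. \<forall>k. Im k < 0 \<longrightarrow>
          (\<forall>u\<in>H_half x. \<not> circle_null x u \<longrightarrow>
            - Re (circle_pairing x (mult_op (\<lambda>m. \<beta> j k m x) x u) u) \<ge> \<mu> k * (circle_norm x u)\<^sup>2 \<and>
            (Re k \<noteq> 0 \<longrightarrow>
               - sgn (Re k) * Im (circle_pairing x (mult_op (\<lambda>m. \<beta> j k m x) x u) u) > 0)))"
    and k: "Im k < 0"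
  then obtain \<mu> :: "complex \<Rightarrow> real" where \<mu>: "\<forall>k. Im k < 0 \<longrightarrow> \<mu> k > 0"
    and H: "\<forall>(j, x)\<in>JJ \<xi>. \<forall>k. Im k < 0 \<longrightarrow>
          (\<forall>u\<in>H_half x. \<not> circle_null x u \<longrightarrow>
            - Re (circle_pairing x (mult_op (\<lambda>m. \<beta> j k m x) x u) u) \<ge> \<mu> k * (circle_norm x u)\<^sup>2 \<and>
            (Re k \<noteq> 0 \<longrightarrow>
               - sgn (Re k) * Im (circle_pairing x (mult_op (\<lambda>m. \<beta> j k m x) x u) u) > 0))"
    by blast
  obtain \<gamma> where \<gamma>: "Re \<gamma> \<le> 0" "0 \<le> Re (\<gamma> * k\<^sup>2)"
    "\<And>j x m. (j, x) \<in> JJ \<xi> \<Longrightarrow> 0 < Re (\<gamma> * \<beta> j k m x)"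
  proof (rule multiplier_sign[of \<xi> k "\<mu> k" "-1" \<beta>])
    fix j x u assume u: "(j, x) \<in> JJ \<xi>" "u \<in> H_half x" "\<not> circle_null x u"
    thus "(Im k \<noteq> 0 \<longrightarrow> - Re (circle_pairing x (mult_op (\<lambda>m. \<beta> j k m x) x u) u) \<ge> \<mu> k * (circle_norm x u)\<^sup>2) \<and>
      (Re k \<noteq> 0 \<longrightarrow> -1 * sgn (Re k) * Im (circle_pairing x (mult_op (\<lambda>m. \<beta> j k m x) x u) u) > 0)"
      using bspec[OF H u(1)] k by simp
  qed (use assms(1) k \<mu> in auto)
  have "well_posed \<xi> 1 (P11 \<xi> n \<beta> k) (h 1 1 k) \<and> well_posed \<xi> 2 (P21 \<xi> n \<beta> k) (h 2 1 k) \<and>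
      well_posed \<xi> 2 (P22 \<xi> n \<beta> k) (h 2 2 k)"
    by (rule well_posed_all[where \<gamma> = \<gamma>]) (rule assms \<gamma> | assumption)+
  thus "well_posed \<xi> 1 (P11 \<xi> n \<beta> k) (h 1 1 k)" "well_posed \<xi> 2 (P21 \<xi> n \<beta> k) (h 2 1 k)"
    "well_posed \<xi> 2 (P22 \<xi> n \<beta> k) (h 2 2 k)"
    by blast+
qed

end
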